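(* Let $q\in\mathbb{N}$ and let $P$ and $Q$ be complex $q\times q$ matrix polynomials such that $\det Q$ does not vanish identically and such that the restriction $\Phi$ of $PQ^{-1}$ onto $\mathbb{D}$ belongs to $\mathcal{C}_q(\mathbb{D})$. Let $\mu$ be the Riesz–Herglotz measure of $\Phi$. Then $\mathcal{N}:=\{u\in\mathbb{T}:\det Q(u)=0\}$ is a finite subset of $\mathbb{T}$ and the following statements hold true: (a) For all $u\in\mathcal{N}$, denoting by $m_u$ the multiplicity of $u$ as a zero of $\det Q$, we have $(\det Q)^{(m_u)}(u)\neq 0$, and $$W_u:=\frac{-m_u}{2u\,(\det Q)^{(m_u)}(u)}\,(PQ^{\sharp})^{(m_u-1)}(u)$$ is a well-defined and non-negative Hermitian matrix which coincides with $\mu(\{u\})$. (b) Let $\Delta:\mathbb{C}\setminus\mathcal{N}\to\mathbb{C}^{q\times q}$ be defined by $\Delta(z):=\sum_{u\in\mathcal{N}}\frac{u+z}{u-z}W_u$. Then $\Theta:=PQ^{-1}-\Delta$ is a rational $q\times q$ matrix-valued function which is holomorphic in $\{z\in\mathbb{C}:|z|<r\}$ for some $r\in(1,+\infty)$, and the restrictions of $\Theta$ and $\Delta$ onto $\mathbb{D}$ both belong to $\mathcal{C}_q(\mathbb{D})$. (c) For all Borel subsets $B$ of $\mathbb{T}$, $$\mu(B)=\frac{1}{2\pi}\int_B\operatorname{Re}\Theta(\zeta)\,\lambda(d\zeta)+\sum_{u\in\mathcal{N}}W_u\,\delta_u(B).$$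
   Context: $\mathbb{D}=\{z\in\mathbb{C}:|z|<1\}$, $\mathbb{T}=\{z\in\mathbb{C}:|z|=1\}$. For $A\in\mathbb{C}^{q\times q}$, $\operatorname{Re}A=\frac12(A+A^* )$, $\operatorname{Im}A=\frac1{2i}(A-A^* )$, and $A^{\sharp}$ is the classical adjugate ($AA^\sharp=A^\sharp A=(\det A)I_q$); $Q^\sharp(z):=[Q(z)]^\sharp$. $f^{(m)}$ denotes the $m$-th derivative. $\lambda$ is the linear Lebesgue (arc length) measure on the Borel $\sigma$-algebra of $\mathbb{T}$ (total mass $2\pi$); $\delta_u$ is the Dirac measure at $u$. An empty sum is the zero matrix. $\mathcal{C}_q(\mathbb{D})$ is the set of $q\times q$ Carathéodory functions in $\mathbb{D}$: holomorphic $\Phi:\mathbb{D}\to\mathbb{C}^{q\times q}$ with $\operatorname{Re}\Phi(z)$ non-negative Hermitian (positive semidefinite) for all $z\in\mathbb{D}$. A non-negative Hermitian $q\times q$ measure on $\mathbb{T}$ is a countably additive map from the Borel $\sigma$-algebra of $\mathbb{T}$ into the non-negative Hermitian complex $q\times q$ matrices. By the matricial Riesz–Herglotz theorem, for each $\Phi\in\mathcal{C}_q(\mathbb{D})$ there is exactly one such measure $\mu$ with $\Phi(z)-i\operatorname{Im}\Phi(0)=\int_{\mathbb{T}}\frac{\zeta+z}{\zeta-z}\mu(d\zeta)$ for all $z\in\mathbb{D}$; it is called the Riesz–Herglotz measure of $\Phi$. Rational (meromorphic) matrix functions are understood with removable singularities removed. *)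

theory Defs
  imports "HOL-Complex_Analysis.Complex_Analysis"
begin

unbundle no fps_syntax

section \<open>Complex matrices\<close>

definition conj_transpose :: "complex^'n^'m \<Rightarrow> complex^'m^'n"
  where "conj_transpose A = (\<chi> i j. cnj (A $ j $ i))"

definition Re_mat :: "complex^'n^'n \<Rightarrow> complex^'n^'n"
  where "Re_mat A = map_matrix ((*) (1/2)) (A + conj_transpose A)"

definition Im_mat :: "complex^'n^'n \<Rightarrow> complex^'n^'n"
  where "Im_mat A = map_matrix ((*) (1 / (2*\<i>))) (A - conj_transpose A)"

definition nonneg_hermitian :: "complex^'n^'n \<Rightarrow> bool"
  where "nonneg_hermitian A \<longleftrightarrow> conj_transpose A = A \<and>
    (\<forall>v. (\<Sum>i\<in>UNIV. cnj (v $ i) * (A *v v) $ i) \<in> \<real>\<^sub>\<ge>\<^sub>0)"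

text \<open>The \<open>(i, j)\<close> entry of the adjugate is the \<open>(j, i)\<close> cofactor of \<open>A\<close>, i.e. the determinant
  of \<open>A\<close> with its \<open>i\<close>-th column replaced by the \<open>j\<close>-th unit vector.\<close>

definition adjugate :: "'a::comm_ring_1^'n^'n \<Rightarrow> 'a^'n^'n"
  where "adjugate A = (\<chi> i j. det (\<chi> k l. if l = i then axis j 1 $ k else A $ k $ l))"

lemma adjugate_mult_left:
  fixes A :: "'a::field^'n^'n"
  shows "adjugate A ** A = mat (det A)"
proof -
  have det_col: "det (\<chi> k l. if l = i then (A *v x) $ k else A $ k $ l) = x $ i * det A"
    for i and x :: "'a^'n"
    by (rule cramer_lemma)
  have *: "(\<Sum>j\<in>UNIV. det (\<chi> k l. if l = i then axis j 1 $ k else A $ k $ l) * b $ j)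
      = det (\<chi> k l. if l = i then b $ k else A $ k $ l)" for i and b :: "'a^'n"
  proof -
    have tr: "det (\<chi> k l. if l = i then c $ k else A $ k $ l)
        = det (\<chi> l. if l = i then c else transpose A $ l)" for c :: "'a^'n"
      by (subst det_transpose[symmetric], rule arg_cong[of _ _ det])
         (auto simp: vec_eq_iff transpose_def)
    have "det (\<chi> l. if l = i then (\<Sum>j\<in>UNIV. b $ j *s axis j 1) else transpose A $ l)
        = (\<Sum>j\<in>UNIV. b $ j * det (\<chi> l. if l = i then axis j 1 else transpose A $ l))"
      by (simp add: det_linear_row_sum det_row_mul)
    then show ?thesis
      unfolding tr basis_expansion by (simp add: mult.commute)
  qed
  show ?thesis
    unfolding vec_eq_iff
  proof (intro allI)
    fix i m
    have col: "A *v axis m 1 = column m A"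
      by (simp add: vec_eq_iff column_def matrix_vector_mult_def axis_def if_distrib cong: if_cong)
    have "(adjugate A ** A) $ i $ m = det (\<chi> k l. if l = i then (A *v axis m 1) $ k else A $ k $ l)"
      using *[of i "column m A"] unfolding col
      by (simp add: matrix_matrix_mult_def adjugate_def column_def)
    then show "(adjugate A ** A) $ i $ m = mat (det A) $ i $ m"
      by (simp add: det_col axis_def mat_def)
  qed
qed


section \<open>Matrix functions of a complex variable\<close>

definition poly_mat :: "complex poly^'n^'m \<Rightarrow> complex \<Rightarrow> complex^'n^'m"
  where "poly_mat P z = map_matrix (\<lambda>p. poly p z) P"

definition holomorphic_mat_on :: "(complex \<Rightarrow> complex^'n^'m) \<Rightarrow> complex set \<Rightarrow> bool"
  where "holomorphic_mat_on F S \<longleftrightarrow> (\<forall>i j. (\<lambda>z. F z $ i $ j) holomorphic_on S)"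

definition deriv_mat :: "nat \<Rightarrow> (complex \<Rightarrow> complex^'n^'m) \<Rightarrow> complex \<Rightarrow> complex^'n^'m"
  where "deriv_mat m F z = (\<chi> i j. (deriv ^^ m) (\<lambda>w. F w $ i $ j) z)"

text \<open>Removal of removable singularities. At a pole of an entry, \<open>remove_sings\<close> returns
  the dummy value 0, so that the entry is not holomorphic on any open set containing the pole.\<close>

definition remove_sings_mat :: "(complex \<Rightarrow> complex^'n^'m) \<Rightarrow> complex \<Rightarrow> complex^'n^'m"
  where "remove_sings_mat F z = (\<chi> i j. remove_sings (\<lambda>w. F w $ i $ j) z)"

text \<open>A rational function is determined by its values outside the zeros of a denominator.\<close>

definition rational_mat :: "(complex \<Rightarrow> complex^'n^'m) \<Rightarrow> bool"
  where "rational_mat F \<longleftrightarrow> (\<forall>i j. \<exists>p q. q \<noteq> 0 \<and>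
    (\<forall>z. poly q z \<noteq> 0 \<longrightarrow> F z $ i $ j = poly p z / poly q z))"

definition caratheodory :: "(complex \<Rightarrow> complex^'n^'n) \<Rightarrow> bool"
  where "caratheodory F \<longleftrightarrow> holomorphic_mat_on F (ball 0 1) \<and>
    (\<forall>z\<in>ball 0 1. nonneg_hermitian (Re_mat (F z)))"


section \<open>Measures on the unit circle\<close>

definition circle_borel :: "complex measure"
  where "circle_borel = restrict_space borel (sphere 0 1)"

definition arc_length :: "complex measure"
  where "arc_length = distr (restrict_space lborel {0..<2*pi}) circle_borel cis"

definition nonneg_hermitian_measure :: "(complex set \<Rightarrow> complex^'n^'n) \<Rightarrow> bool"
  where "nonneg_hermitian_measure \<mu> \<longleftrightarrow>
    (\<forall>B\<in>sets circle_borel. nonneg_hermitian (\<mu> B)) \<and>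
    (\<forall>A :: nat \<Rightarrow> complex set. range A \<subseteq> sets circle_borel \<longrightarrow> disjoint_family A \<longrightarrow>
      (\<lambda>n. \<mu> (A n)) sums \<mu> (\<Union>n. A n))"

text \<open>The entries of a non-negative Hermitian measure are complex measures. A finite signed measure
  \<open>\<nu>\<close> is integrated by means of its Jordan decomposition, whose positive part is the upper variation
  \<open>B \<mapsto> sup {\<nu> A | A \<subseteq> B measurable}\<close> (\<open>ennreal\<close> truncates negative values, which is harmless
  because of \<open>\<nu> {} = 0\<close>) and whose negative part is the positive part of \<open>- \<nu>\<close>. Complex measures are
  integrated by splitting them into real and imaginary parts, matrix measures entrywise.\<close>

definition upper_variation :: "'a measure \<Rightarrow> ('a set \<Rightarrow> real) \<Rightarrow> 'a measure"
  where "upper_variation M \<nu> =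
    measure_of (space M) (sets M) (\<lambda>B. SUP A\<in>{A\<in>sets M. A \<subseteq> B}. ennreal (\<nu> A))"

definition signed_integral :: "'a measure \<Rightarrow> ('a set \<Rightarrow> real) \<Rightarrow> ('a \<Rightarrow> complex) \<Rightarrow> complex"
  where "signed_integral M \<nu> f =
    (LINT x|upper_variation M \<nu>. f x) - (LINT x|upper_variation M (\<lambda>B. - \<nu> B). f x)"

definition complex_measure_integral ::
    "'a measure \<Rightarrow> ('a set \<Rightarrow> complex) \<Rightarrow> ('a \<Rightarrow> complex) \<Rightarrow> complex"
  where "complex_measure_integral M \<nu> f =
    signed_integral M (\<lambda>B. Re (\<nu> B)) f + \<i> * signed_integral M (\<lambda>B. Im (\<nu> B)) f"

definition matrix_measure_integral ::
    "(complex set \<Rightarrow> complex^'n^'n) \<Rightarrow> (complex \<Rightarrow> complex) \<Rightarrow> complex^'n^'n"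
  where "matrix_measure_integral \<mu> f =
    (\<chi> i j. complex_measure_integral circle_borel (\<lambda>B. \<mu> B $ i $ j) f)"

text \<open>By the matricial Riesz--Herglotz theorem, every Caratheodory function has exactly one such
  \<open>\<mu>\<close>, up to its irrelevant values outside the Borel subsets of the circle.\<close>

definition riesz_herglotz_measure ::
    "(complex \<Rightarrow> complex^'n^'n) \<Rightarrow> (complex set \<Rightarrow> complex^'n^'n) \<Rightarrow> bool"
  where "riesz_herglotz_measure F \<mu> \<longleftrightarrow> nonneg_hermitian_measure \<mu> \<and>
    (\<forall>z\<in>ball 0 1. F z - map_matrix ((*) \<i>) (Im_mat (F 0)) =
      matrix_measure_integral \<mu> (\<lambda>\<zeta>. (\<zeta> + z) / (\<zeta> - z)))"


section \<open>Quotients of matrix polynomials\<close>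

text \<open>In this section \<open>P\<close> and \<open>Q\<close> are matrix polynomials, represented by their matrices of
  polynomial entries; thus \<open>det Q\<close> is the polynomial \<open>z \<mapsto> det (Q z)\<close>.\<close>

lemma poly_det: "poly (det Q) z = det (poly_mat Q z)"
  by (simp add: det_def poly_mat_def poly_sum poly_prod)

definition mat_quotient :: "complex poly^'n^'n \<Rightarrow> complex poly^'n^'n \<Rightarrow> complex \<Rightarrow> complex^'n^'n"
  where "mat_quotient P Q =
    remove_sings_mat (\<lambda>z. poly_mat P z ** matrix_inv (poly_mat Q z))"

definition circle_zeros :: "complex poly^'n^'n \<Rightarrow> complex set"
  where "circle_zeros Q = {u \<in> sphere 0 1. det (poly_mat Q u) = 0}"

definition residue_weight ::
    "complex poly^'n^'n \<Rightarrow> complex poly^'n^'n \<Rightarrow> complex \<Rightarrow> complex^'n^'n"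
  where "residue_weight P Q u =
    (let m = order u (det Q) in
      map_matrix ((*) (- of_nat m / (2 * u * (deriv ^^ m) (\<lambda>z. det (poly_mat Q z)) u)))
        (deriv_mat (m - 1) (\<lambda>z. poly_mat P z ** adjugate (poly_mat Q z)) u))"

definition singular_part ::
    "complex poly^'n^'n \<Rightarrow> complex poly^'n^'n \<Rightarrow> complex \<Rightarrow> complex^'n^'n"
  where "singular_part P Q z =
    (\<Sum>u\<in>circle_zeros Q. map_matrix ((*) ((u + z) / (u - z))) (residue_weight P Q u))"

definition regular_part ::
    "complex poly^'n^'n \<Rightarrow> complex poly^'n^'n \<Rightarrow> complex \<Rightarrow> complex^'n^'n"
  where "regular_part P Q =
    remove_sings_mat (\<lambda>z. mat_quotient P Q z - singular_part P Q z)"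

end

theory Submission
  imports Defs
begin

text \<open>For a fixed vector \<open>v\<close> the Herglotz measure induces the finite measure \<open>B \<mapsto> v\<^sup>* \<mu>(B) v\<close>, and by
  polarization all statements reduce to these scalar measures. Dominated convergence in the Herglotz
  formula along the radius to \<open>u\<close> gives \<open>(u - z) \<Phi>(z) \<rightarrow> 2 u \<mu>({u})\<close>; hence the entries of \<open>P Q\<^sup>-\<^sup>1\<close> have at most
  simple poles on the circle, whose residues are given by the weights. Removing the atoms leaves a function that is
  holomorphic across the circle. For such a function Cauchy's formula computes the moments of the real part on the
  circle, and they agree with the moments of the diffuse part of \<open>\<mu>\<close> read off from the power series of the
  Herglotz formula at 0. The moments determine a finite measure on the circle by the
  Stone--Weierstrass theorem.\<close>

text \<open>An obstacle lies in the matrix integral itself: every entry is integrated through Jordan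
  decompositions of its real and imaginary part, and variations do not depend linearly on the
  measure. Simple functions chosen independently of the measure avoid this: their sums are linear in
  the set function, and one sequence serves all finite measures at once. The approach to
  \<open>u\<close> is radial because \<open>norm (u - z) = 1 - norm z\<close> is then at most
  \<open>norm (\<zeta> - z)\<close>, which gives a constant majorant. The factor
  \<open>2 * u\<close> is the value of \<open>\<zeta> + z\<close> at \<open>\<zeta> = z = u\<close>.
  The weights use the multiplicity \<open>m\<close> of \<open>u\<close> in \<open>det Q\<close>,
  which may exceed the pole order of an entry. The finite radial limit shows that each entry of
  \<open>P ** adjugate Q\<close> is divisible by the power \<open>m - 1\<close> of the linear factor
  at \<open>u\<close>; the factor \<open>m\<close> in the weight is then the quotient of the
  factorials of \<open>m\<close> and \<open>m - 1\<close> that the derivatives produce.\<close>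

no_notation fps_nth (infixl "$" 75)

section \<open>Integration against sigma-additive set functions\<close>

text \<open>Values in an arbitrary normed space cover the matrix measure itself as well as the real
  set functions derived from it by bounded linear maps.\<close>

definition sigma_additive_on :: "'a measure \<Rightarrow> ('a set \<Rightarrow> 'b::real_normed_vector) \<Rightarrow> bool"
  where "sigma_additive_on M \<nu> \<longleftrightarrow> (\<forall>A :: nat \<Rightarrow> 'a set. range A \<subseteq> sets M \<longrightarrow> disjoint_family A \<longrightarrow>
    (\<lambda>n. \<nu> (A n)) sums \<nu> (\<Union>n. A n))"

definition set_function_measure :: "'a measure \<Rightarrow> ('a set \<Rightarrow> real) \<Rightarrow> 'a measure"
  where "set_function_measure M \<nu> = measure_of (space M) (sets M) (\<lambda>B. ennreal (\<nu> B))"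

lemma sigma_additive_on_add:
  "sigma_additive_on M \<nu> \<Longrightarrow> sigma_additive_on M \<nu>' \<Longrightarrow> sigma_additive_on M (\<lambda>B. \<nu> B + \<nu>' B)"
  by (auto simp: sigma_additive_on_def intro: sums_add)

lemma sigma_additive_on_bounded_linear:
  "bounded_linear f \<Longrightarrow> sigma_additive_on M \<nu> \<Longrightarrow> sigma_additive_on M (\<lambda>B. f (\<nu> B))"
  by (auto simp: sigma_additive_on_def intro: bounded_linear.sums)

lemma sigma_additive_on_cong:
  assumes "\<And>B. B \<in> sets M \<Longrightarrow> \<nu> B = \<nu>' B"
  shows "sigma_additive_on M \<nu> \<longleftrightarrow> sigma_additive_on M \<nu>'"
proof -
  have "\<nu> (A n) = \<nu>' (A n)" "\<nu> (\<Union>n. A n) = \<nu>' (\<Union>n. A n)" if "range A \<subseteq> sets M" for A :: "nat \<Rightarrow> 'a set" and n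
    using that by (auto intro!: assms)
  then show ?thesis
    by (simp add: sigma_additive_on_def)
qed

text \<open>Apply additivity to a sequence of empty sets: a constant series converges only if its
  term is 0.\<close>

lemma sigma_additive_on_empty:
  assumes "sigma_additive_on M \<nu>"
  shows "\<nu> {} = 0"
proof -
  have "(\<lambda>n::nat. \<nu> {}) sums \<nu> {}"
    using assms[unfolded sigma_additive_on_def, rule_format, of "\<lambda>_. {}"]
    by (auto simp: disjoint_family_on_def)
  then show ?thesis
    using sums_summable summable_const_iff by blast
qed

lemma sigma_additive_on_Un:
  assumes "sigma_additive_on M \<nu>" "A \<in> sets M" "B \<in> sets M" "A \<inter> B = {}"
  shows "\<nu> (A \<union> B) = \<nu> A + \<nu> B"
proof -
  let ?S = "\<lambda>n::nat. if n = 0 then A else if n = 1 then B else {}"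
  have "(\<lambda>n. \<nu> (?S n)) sums \<nu> (\<Union>n. ?S n)"
    using assms by (intro assms(1)[unfolded sigma_additive_on_def, rule_format])
      (auto simp: disjoint_family_on_def)
  moreover have "(\<Union>n. ?S n) = A \<union> B"
    by (auto split: if_splits)
  moreover have "(\<lambda>n. \<nu> (?S n)) sums (\<Sum>n\<in>{0,1}. \<nu> (?S n))"
    by (intro sums_finite) (auto simp: sigma_additive_on_empty[OF assms(1)])
  ultimately show ?thesis
    by (auto dest: sums_unique2)
qed

lemma sigma_additive_on_Int:
  assumes "sigma_additive_on M \<nu>" "Y \<in> sets M"
  shows "sigma_additive_on M (\<lambda>B. \<nu> (B \<inter> Y))"
  unfolding sigma_additive_on_def
proof safe
  fix A :: "nat \<Rightarrow> 'a set" assume A: "range A \<subseteq> sets M" "disjoint_family A"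
  have "(\<lambda>n. \<nu> (A n \<inter> Y)) sums \<nu> (\<Union>n. A n \<inter> Y)"
    using A assms(2) by (intro assms(1)[unfolded sigma_additive_on_def, rule_format])
      (auto simp: disjoint_family_on_def)
  then show "(\<lambda>n. \<nu> (A n \<inter> Y)) sums \<nu> ((\<Union>n. A n) \<inter> Y)"
    by (simp add: Int_UN_distrib2)
qed

lemma sets_set_function_measure [simp, measurable_cong]:
  "sets (set_function_measure M \<nu>) = sets M"
  by (simp add: set_function_measure_def)

lemma space_set_function_measure [simp]: "space (set_function_measure M \<nu>) = space M"
  by (simp add: set_function_measure_def)

lemma emeasure_set_function_measure:
  assumes "sigma_additive_on M \<nu>" "\<And>B. B \<in> sets M \<Longrightarrow> 0 \<le> \<nu> B" "B \<in> sets M"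
  shows "emeasure (set_function_measure M \<nu>) B = ennreal (\<nu> B)"
proof (rule emeasure_measure_of[OF set_function_measure_def])
  show "sets M \<subseteq> Pow (space M)"
    by (rule sets.space_closed)
  show "positive (sets (set_function_measure M \<nu>)) (\<lambda>B. ennreal (\<nu> B))"
    using sigma_additive_on_empty[OF assms(1)] by (simp add: positive_def)
  show "countably_additive (sets (set_function_measure M \<nu>)) (\<lambda>B. ennreal (\<nu> B))"
  proof (rule countably_additiveI)
    fix A :: "nat \<Rightarrow> 'a set"
    assume A: "range A \<subseteq> sets (set_function_measure M \<nu>)" "disjoint_family A"
    then have "(\<lambda>n. \<nu> (A n)) sums \<nu> (\<Union>n. A n)"
      using assms(1) by (auto simp: sigma_additive_on_def)
    then have "(\<lambda>n. ennreal (\<nu> (A n))) sums ennreal (\<nu> (\<Union>n. A n))"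
      using A assms(2) by (subst sums_ennreal) auto
    then show "(\<Sum>i. ennreal (\<nu> (A i))) = ennreal (\<nu> (\<Union> (range A)))"
      by (simp add: sums_iff)
  qed
qed (use assms in auto)

lemma measure_set_function_measure:
  assumes "sigma_additive_on M \<nu>" "\<And>B. B \<in> sets M \<Longrightarrow> 0 \<le> \<nu> B" "B \<in> sets M"
  shows "measure (set_function_measure M \<nu>) B = \<nu> B"
  using emeasure_set_function_measure[OF assms] assms by (simp add: measure_def)

lemma finite_measure_set_function_measure:
  assumes "sigma_additive_on M \<nu>" "\<And>B. B \<in> sets M \<Longrightarrow> 0 \<le> \<nu> B"
  shows "finite_measure (set_function_measure M \<nu>)"
  by (rule finite_measureI) (simp add: emeasure_set_function_measure[OF assms])

text \<open>On a Hahn set \<open>Y\<close> the supremum defining the upper variation is attained at \<open>B \<inter> Y\<close>.\<close>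

lemma upper_variation_eq:
  assumes "sigma_additive_on M \<nu>" "Y \<in> sets M"
    and pos: "\<And>X. X \<in> sets M \<Longrightarrow> X \<subseteq> Y \<Longrightarrow> 0 \<le> \<nu> X"
    and neg: "\<And>X. X \<in> sets M \<Longrightarrow> X \<inter> Y = {} \<Longrightarrow> \<nu> X \<le> 0"
  shows "upper_variation M \<nu> = set_function_measure M (\<lambda>B. \<nu> (B \<inter> Y))"
  unfolding upper_variation_def set_function_measure_def
proof (rule measure_of_eq[OF sets.space_closed])
  fix B assume "B \<in> sigma_sets (space M) (sets M)"
  then have B: "B \<in> sets M"
    by (simp add: sets.sigma_sets_eq)
  show "(SUP A\<in>{A \<in> sets M. A \<subseteq> B}. ennreal (\<nu> A)) = ennreal (\<nu> (B \<inter> Y))"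
  proof (rule SUP_eqI)
    fix A assume A: "A \<in> {A \<in> sets M. A \<subseteq> B}"
    have "\<nu> (A \<inter> Y \<union> (A - Y)) = \<nu> (A \<inter> Y) + \<nu> (A - Y)"
      using A assms(2) by (intro sigma_additive_on_Un[OF assms(1)]) auto
    moreover have "\<nu> (A \<inter> Y \<union> (B - A) \<inter> Y) = \<nu> (A \<inter> Y) + \<nu> ((B - A) \<inter> Y)"
      using A B assms(2) by (intro sigma_additive_on_Un[OF assms(1)]) auto
    moreover have sets_eq: "A \<inter> Y \<union> (A - Y) = A" "A \<inter> Y \<union> (B - A) \<inter> Y = B \<inter> Y"
      using A by auto
    moreover have "\<nu> (A - Y) \<le> 0" "0 \<le> \<nu> ((B - A) \<inter> Y)"
      using A B assms(2) by (auto intro!: pos neg)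
    ultimately show "ennreal (\<nu> A) \<le> ennreal (\<nu> (B \<inter> Y))"
      unfolding sets_eq by (intro ennreal_leI) linarith
  next
    fix y assume "\<And>A. A \<in> {A \<in> sets M. A \<subseteq> B} \<Longrightarrow> ennreal (\<nu> A) \<le> y"
    then show "ennreal (\<nu> (B \<inter> Y)) \<le> y"
      using B assms(2) by auto
  qed
qed

text \<open>A Hahn set \<open>Y\<close> for the two finite measures \<open>\<alpha>\<close> and
  \<open>\<beta>\<close> is one for their difference, so the two variations are \<open>\<nu>\<close>
  restricted to \<open>Y\<close> and \<open>- \<nu>\<close> restricted to its complement. The given
  decomposition need not be the minimal one; polarization supplies one that is not.\<close>

lemma jordan_decomposition:
  fixes \<nu> :: "'a set \<Rightarrow> real"
  assumes "sigma_additive_on M \<alpha>" "\<And>B. B \<in> sets M \<Longrightarrow> 0 \<le> \<alpha> B"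
    and "sigma_additive_on M \<beta>" "\<And>B. B \<in> sets M \<Longrightarrow> 0 \<le> \<beta> B"
    and \<nu>: "\<And>B. B \<in> sets M \<Longrightarrow> \<nu> B = \<alpha> B - \<beta> B"
  shows "finite_measure (upper_variation M \<nu>)" "finite_measure (upper_variation M (\<lambda>B. - \<nu> B))"
    "\<And>B. B \<in> sets M \<Longrightarrow>
      \<nu> B = measure (upper_variation M \<nu>) B - measure (upper_variation M (\<lambda>B. - \<nu> B)) B"
proof -
  let ?a = "set_function_measure M \<alpha>" and ?b = "set_function_measure M \<beta>"
  note fin = finite_measure_set_function_measure[OF assms(1,2)]
    finite_measure_set_function_measure[OF assms(3,4)]
  have em: "emeasure ?a B = ennreal (\<alpha> B)" "emeasure ?b B = ennreal (\<beta> B)" if "B \<in> sets M" for B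
    using emeasure_set_function_measure[OF assms(1,2) that] emeasure_set_function_measure[OF assms(3,4) that]
    by simp_all
  obtain Y where Y': "Y \<in> sets M" "\<forall>X\<in>sets M. X \<subseteq> Y \<longrightarrow> emeasure ?b X \<le> emeasure ?a X"
    "\<forall>X\<in>sets M. X \<inter> Y = {} \<longrightarrow> emeasure ?a X \<le> emeasure ?b X"
    using finite_unsigned_Hahn_decomposition[OF fin] unfolding sets_set_function_measure by blast
  have Y: "Y \<in> sets M" "\<And>X. X \<in> sets M \<Longrightarrow> X \<subseteq> Y \<Longrightarrow> \<beta> X \<le> \<alpha> X"
    "\<And>X. X \<in> sets M \<Longrightarrow> X \<inter> Y = {} \<Longrightarrow> \<alpha> X \<le> \<beta> X"
    using Y' assms(2,4) by (simp_all add: em ennreal_le_iff)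
  have add: "sigma_additive_on M \<nu>"
    using sigma_additive_on_add[OF assms(1)
        sigma_additive_on_bounded_linear[OF bounded_linear_minus[OF bounded_linear_ident] assms(3)]]
    by (subst sigma_additive_on_cong[of M \<nu> "\<lambda>B. \<alpha> B + - \<beta> B"]) (simp_all add: \<nu>)
  have add': "sigma_additive_on M (\<lambda>B. - \<nu> B)"
    by (rule sigma_additive_on_bounded_linear[OF bounded_linear_minus[OF bounded_linear_ident] add])
  let ?Z = "space M - Y"
  have Z: "?Z \<in> sets M"
    using Y(1) by auto
  have p: "upper_variation M \<nu> = set_function_measure M (\<lambda>B. \<nu> (B \<inter> Y))"
    by (rule upper_variation_eq[OF add Y(1)]) (use Y in \<open>auto simp: \<nu>\<close>)
  have n: "upper_variation M (\<lambda>B. - \<nu> B) = set_function_measure M (\<lambda>B. - \<nu> (B \<inter> ?Z))"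
  proof (rule upper_variation_eq[OF add' Z])
    fix X assume X: "X \<in> sets M" "X \<inter> ?Z = {}"
    then have "X \<subseteq> Y"
      using sets.sets_into_space by fastforce
    then show "- \<nu> X \<le> 0"
      using X Y by (simp add: \<nu>)
  qed (use Y(3) in \<open>auto simp: \<nu>\<close>)
  have ap: "sigma_additive_on M (\<lambda>B. \<nu> (B \<inter> Y))" "sigma_additive_on M (\<lambda>B. - \<nu> (B \<inter> ?Z))"
    by (rule sigma_additive_on_Int[OF add Y(1)], rule sigma_additive_on_Int[OF add' Z])
  have pos: "0 \<le> \<nu> (B \<inter> Y)" "0 \<le> - \<nu> (B \<inter> ?Z)" if "B \<in> sets M" for B
    using that Y(1) Z Y(2)[of "B \<inter> Y"] Y(3)[of "B \<inter> ?Z"] by (auto simp: \<nu>)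
  show "finite_measure (upper_variation M \<nu>)"
    unfolding p by (rule finite_measure_set_function_measure[OF ap(1) pos(1)])
  show "finite_measure (upper_variation M (\<lambda>B. - \<nu> B))"
    unfolding n by (rule finite_measure_set_function_measure[OF ap(2) pos(2)])
  show "\<nu> B = measure (upper_variation M \<nu>) B - measure (upper_variation M (\<lambda>B. - \<nu> B)) B"
    if B: "B \<in> sets M" for B
  proof -
    have "B = B \<inter> Y \<union> B \<inter> ?Z"
      using sets.sets_into_space[OF B] by auto
    then have "\<nu> B = \<nu> (B \<inter> Y) + \<nu> (B \<inter> ?Z)"
      using sigma_additive_on_Un[OF add, of "B \<inter> Y" "B \<inter> ?Z"] B Y(1) Z by auto
    then show ?thesis
      unfolding p n by (simp add: measure_set_function_measure[OF ap(1) pos(1) B]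
          measure_set_function_measure[OF ap(2) pos(2) B])
  qed
qed

section \<open>Integrals as limits of sums over level sets\<close>

text \<open>The order of the quantifiers is the point: \<open>Y\<close> and \<open>A\<close> come
  from simple functions approximating \<open>f\<close> pointwise and are fixed before the measure
  \<open>N\<close>. Limits for different measures can therefore be combined linearly.\<close>

lemma simple_approximation_integral:
  fixes f :: "'a \<Rightarrow> complex"
  assumes [measurable]: "f \<in> borel_measurable M" and bound: "\<And>x. x \<in> space M \<Longrightarrow> norm (f x) \<le> K"
  obtains Y :: "nat \<Rightarrow> complex set" and A :: "nat \<Rightarrow> complex \<Rightarrow> 'a set"
  where "\<And>k. finite (Y k)" "\<And>k y. A k y \<in> sets M"
    "\<And>N. finite_measure N \<Longrightarrow> sets N = sets M \<Longrightarrow>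
      (\<lambda>k. \<Sum>y\<in>Y k. y * of_real (measure N (A k y))) \<longlonglongrightarrow> (LINT x|N. f x)"
proof -
  obtain F where F': "\<forall>i. simple_function M (F i)" "\<forall>x\<in>space M. (\<lambda>i. F i x) \<longlonglongrightarrow> f x"
    "\<forall>i. \<forall>x\<in>space M. dist (F i x) 0 \<le> 2 * dist (f x) 0"
    using borel_measurable_implies_sequence_metric[OF assms(1), of 0] by blast
  then have F: "\<And>i. simple_function M (F i)" "\<And>x. x \<in> space M \<Longrightarrow> (\<lambda>i. F i x) \<longlonglongrightarrow> f x"
    "\<And>i x. x \<in> space M \<Longrightarrow> norm (F i x) \<le> 2 * norm (f x)"
    by simp_all
  show ?thesis
  proof (rule that[of "\<lambda>k. F k ` space M" "\<lambda>k y. {x\<in>space M. F k x = y}"])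
    show "finite (F k ` space M)" for k
      using F(1) by (simp add: simple_function_def)
    show "{x\<in>space M. F k x = y} \<in> sets M" for k y
      using F(1)[of k] borel_measurable_simple_function[of M "F k"] by measurable
    fix N :: "'a measure" assume N: "finite_measure N" "sets N = sets M"
    interpret finite_measure N by fact
    have [simp]: "space N = space M"
      using N(2) by (rule sets_eq_imp_space_eq)
    have sf: "simple_function N (F k)" for k
      using F(1)[of k] N(2) by (simp add: simple_function_def)
    have "(LINT x|N. F k x) = (\<Sum>y\<in>F k ` space M. y * of_real (measure N {x\<in>space M. F k x = y}))" for k
    proof -
      have "Bochner_Integration.simple_bochner_integrable N (F k)"
        using sf[of k] by (simp add: Bochner_Integration.simple_bochner_integrable.simps)
      then have "(LINT x|N. F k x) = Bochner_Integration.simple_bochner_integral N (F k)"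
        by (rule has_bochner_integral_integral_eq[OF has_bochner_integral_simple_bochner_integrable])
      then show ?thesis
        by (simp add: Bochner_Integration.simple_bochner_integral_def scaleR_conv_of_real mult.commute)
    qed
    moreover have "(\<lambda>k. LINT x|N. F k x) \<longlonglongrightarrow> (LINT x|N. f x)"
    proof (rule integral_dominated_convergence)
      show "f \<in> borel_measurable N"
        using assms(1) N(2) measurable_cong_sets by blast
      show "F k \<in> borel_measurable N" for k
        using sf by (rule borel_measurable_simple_function)
      \<comment> \<open>The factor 2 comes from the approximants, whose norms are at most twice the
        norm of \<open>f\<close>; a constant majorant is integrable for every finite
        measure.\<close>
      show "integrable N (\<lambda>x. 2 * K)"
        by simp
      show "AE x in N. norm (F k x) \<le> 2 * K" for k
        using F(3) bound by (intro AE_I2) (smt (verit) \<open>space N = space M\<close>)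
    qed (use F(2) in auto)
    ultimately show "(\<lambda>k. \<Sum>y\<in>F k ` space M. y * of_real (measure N {x\<in>space M. F k x = y}))
        \<longlonglongrightarrow> (LINT x|N. f x)"
      by simp
  qed
qed

text \<open>The variations are finite measures whose differences are the real and imaginary parts of
  \<open>\<nu>\<close>, so their approximating sums recombine to an expression that is visibly
  linear in \<open>\<nu>\<close>. This is the form in which the integral can be compared with other
  integrals.\<close>

lemma complex_measure_integral_tendsto:
  fixes Y :: "nat \<Rightarrow> complex set" and A :: "nat \<Rightarrow> complex \<Rightarrow> 'a set"
  assumes approx: "\<And>N. finite_measure N \<Longrightarrow> sets N = sets M \<Longrightarrow>
      (\<lambda>k. \<Sum>y\<in>Y k. y * of_real (measure N (A k y))) \<longlonglongrightarrow> (LINT x|N. f x)"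
    and A: "\<And>k y. A k y \<in> sets M"
    and additive: "sigma_additive_on M \<alpha>" "sigma_additive_on M \<beta>" "sigma_additive_on M \<alpha>'" "sigma_additive_on M \<beta>'"
    and nonneg: "\<And>B. B \<in> sets M \<Longrightarrow> 0 \<le> \<alpha> B" "\<And>B. B \<in> sets M \<Longrightarrow> 0 \<le> \<beta> B"
      "\<And>B. B \<in> sets M \<Longrightarrow> 0 \<le> \<alpha>' B" "\<And>B. B \<in> sets M \<Longrightarrow> 0 \<le> \<beta>' B"
    and \<nu>: "\<And>B. B \<in> sets M \<Longrightarrow> Re (\<nu> B) = \<alpha> B - \<beta> B" "\<And>B. B \<in> sets M \<Longrightarrow> Im (\<nu> B) = \<alpha>' B - \<beta>' B"
  shows "(\<lambda>k. \<Sum>y\<in>Y k. y * \<nu> (A k y)) \<longlonglongrightarrow> complex_measure_integral M \<nu> f"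
proof -
  have sets: "sets (upper_variation M \<sigma>) = sets M" for \<sigma> :: "'a set \<Rightarrow> real"
    by (simp add: upper_variation_def)
  have lim: "(\<lambda>k. \<Sum>y\<in>Y k. y * of_real (\<sigma> (A k y))) \<longlonglongrightarrow> signed_integral M \<sigma> f"
    if "sigma_additive_on M a" "\<And>B. B \<in> sets M \<Longrightarrow> 0 \<le> a B"
      and "sigma_additive_on M b" "\<And>B. B \<in> sets M \<Longrightarrow> 0 \<le> b B"
      and "\<And>B. B \<in> sets M \<Longrightarrow> \<sigma> B = a B - b B" for \<sigma> a b :: "'a set \<Rightarrow> real"
  proof -
    have jordan: "finite_measure (upper_variation M \<sigma>)"
      "finite_measure (upper_variation M (\<lambda>B. - \<sigma> B))"
      "\<And>B. B \<in> sets M \<Longrightarrow>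
        \<sigma> B = measure (upper_variation M \<sigma>) B - measure (upper_variation M (\<lambda>B. - \<sigma> B)) B"
      by (rule jordan_decomposition[of M a b \<sigma>]; use that in blast)+
    show ?thesis
      unfolding signed_integral_def
      using tendsto_diff[OF approx[OF jordan(1) sets] approx[OF jordan(2) sets]]
      by (simp add: jordan(3)[OF A] algebra_simps flip: sum_subtractf)
  qed
  have re: "(\<lambda>k. \<Sum>y\<in>Y k. y * of_real (Re (\<nu> (A k y)))) \<longlonglongrightarrow> signed_integral M (\<lambda>B. Re (\<nu> B)) f"
    by (rule lim[of \<alpha> \<beta>]) (use additive nonneg \<nu> in blast)+
  have im: "(\<lambda>k. \<Sum>y\<in>Y k. y * of_real (Im (\<nu> (A k y)))) \<longlonglongrightarrow> signed_integral M (\<lambda>B. Im (\<nu> B)) f"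
    by (rule lim[of \<alpha>' \<beta>']) (use additive nonneg \<nu> in blast)+
  have "(\<Sum>y\<in>Y k. y * \<nu> (A k y)) = (\<Sum>y\<in>Y k. y * of_real (Re (\<nu> (A k y))))
      + \<i> * (\<Sum>y\<in>Y k. y * of_real (Im (\<nu> (A k y))))" for k
    unfolding sum_distrib_left sum.distrib[symmetric]
    by (intro sum.cong refl) (simp add: complex_eq_iff algebra_simps)
  then show ?thesis
    unfolding complex_measure_integral_def
    using tendsto_add[OF re tendsto_mult_left[OF im, of \<i>]] by simp
qed

section \<open>Quadratic forms of complex matrices\<close>

definition quad :: "complex^'n \<Rightarrow> complex^'n^'n \<Rightarrow> complex"
  where "quad v A = (\<Sum>i\<in>UNIV. cnj (v $ i) * (A *v v) $ i)"

lemma quad_altdef: "quad v A = (\<Sum>i\<in>UNIV. \<Sum>j\<in>UNIV. cnj (v $ i) * v $ j * A $ i $ j)"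
  by (simp add: quad_def matrix_vector_mult_def sum_distrib_left mult_ac)

lemma quad_scale: "quad v (map_matrix ((*) c) A) = c * quad v A"
  by (simp add: quad_altdef map_matrix_def sum_distrib_left mult_ac)

lemma quad_add: "quad v (A + B) = quad v A + quad v B"
  by (simp add: quad_altdef sum.distrib ring_distribs)

lemma quad_diff: "quad v (A - B) = quad v A - quad v B"
  by (simp add: quad_altdef sum_subtractf ring_distribs)

lemma quad_scaleR: "quad v (c *\<^sub>R A) = c *\<^sub>R quad v A"
  by (simp add: quad_altdef scaleR_sum_right)

lemma bounded_linear_quad: "bounded_linear (quad v)"
  by (intro linear_conv_bounded_linear[THEN iffD1] linearI quad_add quad_scaleR)

lemma quad_sum: "quad v (\<Sum>x\<in>S. F x) = (\<Sum>x\<in>S. quad v (F x))"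
  by (rule linear_sum[OF bounded_linear.linear[OF bounded_linear_quad]])

lemma quad_conj_transpose: "quad v (conj_transpose A) = cnj (quad v A)"
  unfolding quad_altdef by (subst sum.swap) (simp add: conj_transpose_def mult_ac)

lemma quad_Re_mat: "quad v (Re_mat A) = of_real (Re (quad v A))"
  by (simp add: Re_mat_def quad_scale quad_add quad_conj_transpose complex_eq_iff)

lemma quad_Im_mat: "quad v (Im_mat A) = of_real (Im (quad v A))"
  by (simp add: Im_mat_def quad_scale quad_diff quad_conj_transpose complex_eq_iff)

lemma quad_axis_add:
  "quad (axis i a + axis j b) A =
    cnj a * a * A $ i $ i + cnj a * b * A $ i $ j + cnj b * a * A $ j $ i + cnj b * b * A $ j $ j"
proof -
  have ax: "(axis i a + axis j b) $ k = (if k = i then a else 0) + (if k = j then b else 0)" for k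
    by (simp add: axis_def)
  have *: "(A *v (axis i a + axis j b)) $ k = A $ k $ i * a + A $ k $ j * b" for k
    unfolding matrix_vector_mult_def by (simp add: ax sum.distrib ring_distribs
        if_distrib[of "\<lambda>x. _ * x"] del: vector_add_component cong: if_cong)
  show ?thesis
    unfolding quad_def * ax by (simp add: sum.distrib ring_distribs if_distrib[of cnj]
        mult_delta_left cong: if_cong)
qed

lemma quad_axis: "quad (axis i 1) A = A $ i $ i"
  using quad_axis_add[of i 1 i 0 A] by (simp add: axis_def zero_vec_def[symmetric])

text \<open>In the first two forms the off-diagonal contributions are
  \<open>A $ i $ j + A $ j $ i\<close> and \<open>\<i> * (A $ i $ j - A $ j $ i)\<close>.
  Multiplying the second by \<open>- \<i>\<close> and adding cancels \<open>A $ j $ i\<close> and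
  doubles \<open>A $ i $ j\<close>; the last two forms remove the diagonal. The case
  \<open>i = j\<close> is included.\<close>

lemma polarization:
  "A $ i $ j = (quad (axis i 1 + axis j 1) A - \<i> * quad (axis i 1 + axis j \<i>) A
    - (1 - \<i>) * (quad (axis i 1) A + quad (axis j 1) A)) / 2"
  unfolding quad_axis_add quad_axis by (simp add: algebra_simps)

lemma quad_eqI:
  assumes "\<And>v. quad v A = quad v B"
  shows "A = B"
  unfolding vec_eq_iff by (subst (1 2) polarization) (simp add: assms)

text \<open>Over the complex numbers positivity already forces symmetry: a matrix and its conjugate
  transpose have conjugate forms, which agree when the forms are real, and forms determine the
  matrix.\<close>

lemma nonneg_hermitian_iff: "nonneg_hermitian A \<longleftrightarrow> (\<forall>v. quad v A \<in> \<real>\<^sub>\<ge>\<^sub>0)"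
proof -
  have "conj_transpose A = A" if "\<forall>v. quad v A \<in> \<real>\<^sub>\<ge>\<^sub>0"
    by (rule quad_eqI) (use that in \<open>auto simp: quad_conj_transpose complex_nonneg_Reals_iff complex_eq_iff\<close>)
  then show ?thesis
    by (auto simp: nonneg_hermitian_def quad_def)
qed

lemma nonneg_hermitian_quad:
  assumes "nonneg_hermitian A"
  shows "0 \<le> Re (quad v A)" "Im (quad v A) = 0" "quad v A = of_real (Re (quad v A))"
  using assms by (auto simp: nonneg_hermitian_iff complex_nonneg_Reals_iff complex_eq_iff)

lemma nonneg_hermitian_Re_mat: "nonneg_hermitian (Re_mat A) \<longleftrightarrow> (\<forall>v. 0 \<le> Re (quad v A))"
  by (simp add: nonneg_hermitian_iff quad_Re_mat complex_nonneg_Reals_iff)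

text \<open>Real and imaginary part of the polarization identity for real forms. Each right-hand
  side is a difference of two non-negative terms, which is the shape required of
  \<open>\<nu>\<close> in \<open>complex_measure_integral_tendsto\<close>.\<close>

lemma nonneg_hermitian_entry:
  assumes "nonneg_hermitian A"
  shows "Re (A $ i $ j) = Re (quad (axis i 1 + axis j 1) A) / 2
      - (Re (quad (axis i 1) A) + Re (quad (axis j 1) A)) / 2"
    and "Im (A $ i $ j) = (Re (quad (axis i 1) A) + Re (quad (axis j 1) A)) / 2
      - Re (quad (axis i 1 + axis j \<i>) A) / 2"
  by (simp_all add: polarization[of A i j] nonneg_hermitian_quad(2)[OF assms] field_simps)

section \<open>The scalar measures of a non-negative Hermitian measure\<close>

lemma space_circle_borel [simp]: "space circle_borel = sphere 0 1"
  by (simp add: circle_borel_def space_restrict_space)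

lemma sets_circle_borel: "B \<in> sets circle_borel \<longleftrightarrow> B \<in> sets borel \<and> B \<subseteq> sphere 0 1"
  unfolding circle_borel_def by (subst sets_restrict_space_iff) auto

definition quad_measure :: "(complex set \<Rightarrow> complex^'n^'n) \<Rightarrow> complex^'n \<Rightarrow> complex measure"
  where "quad_measure \<mu> v = set_function_measure circle_borel (\<lambda>B. Re (quad v (\<mu> B)))"

lemma
  shows sets_quad_measure [simp, measurable_cong]: "sets (quad_measure \<mu> v) = sets circle_borel"
    and space_quad_measure [simp]: "space (quad_measure \<mu> v) = sphere 0 1"
  by (simp_all add: quad_measure_def)

context
  fixes \<mu> :: "complex set \<Rightarrow> complex^'n^'n"
  assumes \<mu>: "nonneg_hermitian_measure \<mu>"
begin

lemma sigma_additive_quad: "sigma_additive_on circle_borel (\<lambda>B. Re (quad v (\<mu> B)))"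
proof -
  have "sigma_additive_on circle_borel \<mu>"
    using \<mu> by (auto simp: nonneg_hermitian_measure_def sigma_additive_on_def)
  then show ?thesis
    by (rule sigma_additive_on_bounded_linear
        [OF bounded_linear_compose[OF bounded_linear_Re bounded_linear_quad]])
qed

lemma nonneg_quad: "B \<in> sets circle_borel \<Longrightarrow> 0 \<le> Re (quad v (\<mu> B))"
  using \<mu> by (auto simp: nonneg_hermitian_measure_def intro: nonneg_hermitian_quad)

lemma finite_quad_measure: "finite_measure (quad_measure \<mu> v)"
  unfolding quad_measure_def
  by (rule finite_measure_set_function_measure[OF sigma_additive_quad nonneg_quad])

lemma measure_quad_measure:
  "B \<in> sets circle_borel \<Longrightarrow> of_real (measure (quad_measure \<mu> v) B) = quad v (\<mu> B)"
  using \<mu> unfolding quad_measure_def nonneg_hermitian_measure_def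
  by (subst measure_set_function_measure[OF sigma_additive_quad nonneg_quad])
    (auto simp flip: nonneg_hermitian_quad)

text \<open>The two sides rest on unrelated variations, but the same sums over level sets converge
  to both: entrywise on the left, with the form applied to each matrix \<open>\<mu> (A k y)\<close>
  on the right.\<close>

lemma quad_matrix_measure_integral:
  assumes f: "f \<in> borel_measurable circle_borel" "\<And>x. x \<in> sphere 0 1 \<Longrightarrow> norm (f x) \<le> K"
  shows "quad v (matrix_measure_integral \<mu> f) = (LINT x|quad_measure \<mu> v. f x)"
proof -
  let ?q = "\<lambda>v B. Re (quad v (\<mu> B))"
  obtain Y A where Y: "\<And>k. finite (Y k)" and A: "\<And>k y. A k y \<in> sets circle_borel"
    and approx: "\<And>N. finite_measure N \<Longrightarrow> sets N = sets circle_borel \<Longrightarrow>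
      (\<lambda>k. \<Sum>y\<in>Y k. y * of_real (measure N (A k y))) \<longlonglongrightarrow> (LINT x|N. f x)"
    by (rule simple_approximation_integral[OF f(1), of K]) (use f(2) in auto)
  have herm: "nonneg_hermitian (\<mu> B)" if "B \<in> sets circle_borel" for B
    using \<mu> that by (simp add: nonneg_hermitian_measure_def)
  have half: "sigma_additive_on circle_borel (\<lambda>B. \<nu> B / 2)"
    if "sigma_additive_on circle_borel \<nu>" for \<nu> :: "complex set \<Rightarrow> real"
    using that by (rule sigma_additive_on_bounded_linear[OF bounded_linear_divide])
  have "(\<lambda>k. \<Sum>y\<in>Y k. y * \<mu> (A k y) $ i $ j)
      \<longlonglongrightarrow> complex_measure_integral circle_borel (\<lambda>B. \<mu> B $ i $ j) f" for i j
    by (rule complex_measure_integral_tendsto[OF approx A,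
        where \<alpha> = "\<lambda>B. ?q (axis i 1 + axis j 1) B / 2"
          and \<beta> = "\<lambda>B. (?q (axis i 1) B + ?q (axis j 1) B) / 2"
          and \<alpha>' = "\<lambda>B. (?q (axis i 1) B + ?q (axis j 1) B) / 2"
          and \<beta>' = "\<lambda>B. ?q (axis i 1 + axis j \<i>) B / 2"])
      (auto intro!: half sigma_additive_on_add sigma_additive_quad add_nonneg_nonneg nonneg_quad
        simp: nonneg_hermitian_entry[OF herm])
  then have "(\<lambda>k. \<Sum>i\<in>UNIV. \<Sum>j\<in>UNIV. cnj (v $ i) * v $ j * (\<Sum>y\<in>Y k. y * \<mu> (A k y) $ i $ j))
      \<longlonglongrightarrow> quad v (matrix_measure_integral \<mu> f)"
    unfolding quad_altdef matrix_measure_integral_def by (auto intro!: tendsto_intros)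
  moreover have "(\<Sum>i\<in>UNIV. \<Sum>j\<in>UNIV. cnj (v $ i) * v $ j * (\<Sum>y\<in>Y k. y * \<mu> (A k y) $ i $ j))
      = (\<Sum>y\<in>Y k. y * quad v (\<mu> (A k y)))" for k
  proof -
    have "(\<Sum>y\<in>Y k. y * quad v (\<mu> (A k y)))
        = (\<Sum>y\<in>Y k. \<Sum>i\<in>UNIV. \<Sum>j\<in>UNIV. cnj (v $ i) * v $ j * (y * \<mu> (A k y) $ i $ j))"
      by (simp add: quad_altdef sum_distrib_left mult_ac)
    also have "\<dots> = (\<Sum>i\<in>UNIV. \<Sum>j\<in>UNIV. \<Sum>y\<in>Y k. cnj (v $ i) * v $ j * (y * \<mu> (A k y) $ i $ j))"
      by (subst sum.swap, intro sum.cong refl, subst sum.swap) simp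
    finally show ?thesis
      by (simp add: sum_distrib_left)
  qed
  moreover have "(\<lambda>k. \<Sum>y\<in>Y k. y * quad v (\<mu> (A k y))) \<longlonglongrightarrow> (LINT x|quad_measure \<mu> v. f x)"
    using approx[OF finite_quad_measure[of v]] by (simp add: measure_quad_measure[OF A])
  ultimately show ?thesis
    by (auto intro: LIMSEQ_unique)
qed

end

section \<open>Finite measures on the unit circle\<close>

lemma borel_measurable_circle:
  assumes "sets N = sets circle_borel" "continuous_on (sphere 0 1) f"
  shows "f \<in> borel_measurable N"
  unfolding measurable_cong_sets[OF assms(1) refl] circle_borel_def
  by (rule borel_measurable_continuous_on_restrict[OF assms(2)])

lemma integrable_circle:
  fixes f :: "complex \<Rightarrow> 'b::{banach, second_countable_topology}"
  assumes "finite_measure N" "sets N = sets circle_borel" "continuous_on (sphere 0 1) f"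
  shows "integrable N f"
proof -
  interpret finite_measure N by fact
  have "bounded (f ` sphere 0 1)"
    by (intro compact_imp_bounded compact_continuous_image assms compact_sphere)
  then obtain K where "\<forall>x\<in>sphere 0 1. norm (f x) \<le> K"
    by (auto simp: bounded_iff)
  moreover have "space N = sphere 0 1"
    using sets_eq_imp_space_eq[OF assms(2)] by simp
  ultimately show ?thesis
    by (intro integrable_const_bound[of _ K] AE_I2 borel_measurable_circle[OF assms(2,3)]) auto
qed

lemma sets_arc_length [simp, measurable_cong]: "sets arc_length = sets circle_borel"
  and space_arc_length [simp]: "space arc_length = sphere 0 1"
  by (simp_all add: arc_length_def)

lemma cis_measurable_circle: "cis \<in> restrict_space lborel {0..<2*pi} \<rightarrow>\<^sub>M circle_borel"
  unfolding circle_borel_def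
  by (intro measurable_restrict_space2 measurable_restrict_space1)
    (auto intro!: borel_measurable_continuous_onI continuous_intros)

lemma finite_measure_arc_length: "finite_measure arc_length"
  unfolding arc_length_def
  by (intro finite_measure.finite_measure_distr cis_measurable_circle finite_measureI)
    (simp add: space_restrict_space emeasure_restrict_space)

lemma integral_arc_length:
  fixes f :: "complex \<Rightarrow> complex"
  assumes "continuous_on (sphere 0 1) f"
  shows "(LINT \<zeta>|arc_length. f \<zeta>) = integral {0..2*pi} (\<lambda>t. f (cis t))"
proof -
  have cont: "continuous_on {0..2*pi} (\<lambda>t. f (cis t))"
    by (rule continuous_on_compose2[OF assms]) (auto intro!: continuous_intros)
  have int: "set_integrable lborel {0..<2*pi} (\<lambda>t. f (cis t))"
    by (rule set_integrable_subset[OF borel_integrable_atLeastAtMost'[OF cont]]) auto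
  have "(LINT \<zeta>|arc_length. f \<zeta>) = (LINT t|restrict_space lborel {0..<2*pi}. f (cis t))"
    unfolding arc_length_def
    by (rule integral_distr[OF cis_measurable_circle borel_measurable_circle[OF refl assms]])
  also have "\<dots> = (LINT t:{0..<2*pi}|lborel. f (cis t))"
    by (simp add: integral_restrict_space set_lebesgue_integral_def)
  also have "\<dots> = integral {0..<2*pi} (\<lambda>t. f (cis t))"
    by (rule set_borel_integral_eq_integral(2)[OF int])
  \<comment> \<open>The half-open interval traverses the circle once; adding the endpoint, a null
    set, gives the interval on which circle path integrals are expressed.\<close>
  also have "\<dots> = integral {0..2*pi} (\<lambda>t. f (cis t))"
    by (rule integral_spike_set; rule negligible_subset[of "{2*pi}"]) auto
  finally show ?thesis .
qed

section \<open>Moments of boundary values and of Herglotz integrals\<close>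

text \<open>On the circle \<open>cnj \<zeta>\<close> is the inverse of \<open>\<zeta>\<close> and
  the line element of the path is \<open>\<i> * \<zeta>\<close> times that of the angle, so this is
  Cauchy's formula for the \<open>k\<close>-th Taylor coefficient; \<open>r > 1\<close> makes it
  applicable on the closed unit disc.\<close>

lemma holomorphic_moment:
  fixes \<psi> :: "complex \<Rightarrow> complex"
  assumes "\<psi> holomorphic_on ball 0 r" "r > 1"
  shows "(LINT \<zeta>|arc_length. \<psi> \<zeta> * cnj \<zeta> ^ k) = 2 * pi * ((deriv ^^ k) \<psi> 0 / fact k)"
proof -
  have sub: "cball 0 1 \<subseteq> ball (0::complex) r" "ball 0 1 \<subseteq> ball (0::complex) r"
    "sphere 0 1 \<subseteq> ball (0::complex) r"
    using assms(2) by auto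
  have cont: "continuous_on (cball 0 1) \<psi>"
    using assms(1) sub(1) holomorphic_on_imp_continuous_on holomorphic_on_subset by blast
  have "((\<lambda>u. \<psi> u / (u - 0) ^ Suc k) has_contour_integral
      ((2 * pi * \<i>) / fact k * (deriv ^^ k) \<psi> 0)) (circlepath 0 1)"
    by (rule Cauchy_has_contour_integral_higher_derivative_circlepath[OF cont
          holomorphic_on_subset[OF assms(1) sub(2)]]) auto
  then have "((\<lambda>t. \<psi> (cis t) / cis t ^ Suc k * \<i> * cis t) has_integral
      ((2 * pi * \<i>) / fact k * (deriv ^^ k) \<psi> 0)) {0..2*pi}"
    by (simp add: circlepath_def has_contour_integral_part_circlepath_iff)
  then have "((\<lambda>t. - \<i> * (\<psi> (cis t) / cis t ^ Suc k * \<i> * cis t)) has_integral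
      (- \<i> * ((2 * pi * \<i>) / fact k * (deriv ^^ k) \<psi> 0))) {0..2*pi}"
    by (rule has_integral_mult_right)
  moreover have "- \<i> * (\<psi> (cis t) / cis t ^ Suc k * \<i> * cis t) = \<psi> (cis t) * cnj (cis t) ^ k" for t
    by (simp add: cis_cnj flip: cis_inverse power_inverse) (simp add: field_simps)
  moreover have "- \<i> * ((2 * pi * \<i>) / fact k * (deriv ^^ k) \<psi> 0) = 2 * pi * ((deriv ^^ k) \<psi> 0 / fact k)"
    by (simp add: field_simps)
  ultimately have "integral {0..2*pi} (\<lambda>t. \<psi> (cis t) * cnj (cis t) ^ k)
      = 2 * pi * ((deriv ^^ k) \<psi> 0 / fact k)"
    by (metis (no_types, lifting) has_integral_cong integral_unique)
  moreover have "continuous_on (sphere 0 1) (\<lambda>\<zeta>. \<psi> \<zeta> * cnj \<zeta> ^ k)"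
    by (intro continuous_intros holomorphic_on_imp_continuous_on
        holomorphic_on_subset[OF assms(1) sub(3)])
  ultimately show ?thesis
    by (simp add: integral_arc_length)
qed

text \<open>Half of the sum of \<open>\<psi>\<close> and its conjugate. The conjugate half
  contributes the mean value of \<open>\<psi> \<zeta> * \<zeta> ^ k\<close>, which vanishes unless
  \<open>k = 0\<close>; hence the case distinction.\<close>

lemma Re_holomorphic_moment:
  fixes \<psi> :: "complex \<Rightarrow> complex"
  assumes "\<psi> holomorphic_on ball 0 r" "r > 1"
  shows "(LINT \<zeta>|arc_length. Re (\<psi> \<zeta>) * cnj \<zeta> ^ k) =
    pi * (if k = 0 then 2 * of_real (Re (\<psi> 0)) else (deriv ^^ k) \<psi> 0 / fact k)"
proof -
  have "sphere 0 1 \<subseteq> ball (0::complex) r"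
    using assms(2) by auto
  then have cont: "continuous_on (sphere 0 1) \<psi>"
    using assms(1) holomorphic_on_imp_continuous_on holomorphic_on_subset by blast
  note int = integrable_circle[OF finite_measure_arc_length sets_arc_length]
  have "(LINT \<zeta>|arc_length. Re (\<psi> \<zeta>) * cnj \<zeta> ^ k)
      = (LINT \<zeta>|arc_length. (\<psi> \<zeta> * cnj \<zeta> ^ k + cnj (\<psi> \<zeta> * \<zeta> ^ k)) / 2)"
  proof (rule Bochner_Integration.integral_cong[OF refl])
    fix \<zeta> :: complex
    have "of_real (Re x) * cnj y = (x * cnj y + cnj (x * y)) / 2" for x y :: complex
      by (simp add: complex_eq_iff algebra_simps)
    from this[of "\<psi> \<zeta>" "\<zeta> ^ k"]
    show "of_real (Re (\<psi> \<zeta>)) * cnj \<zeta> ^ k = (\<psi> \<zeta> * cnj \<zeta> ^ k + cnj (\<psi> \<zeta> * \<zeta> ^ k)) / 2"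
      by simp
  qed
  also have "\<dots> = ((LINT \<zeta>|arc_length. \<psi> \<zeta> * cnj \<zeta> ^ k) + cnj (LINT \<zeta>|arc_length. \<psi> \<zeta> * \<zeta> ^ k)) / 2"
  proof -
    have i: "integrable arc_length (\<lambda>\<zeta>. \<psi> \<zeta> * cnj \<zeta> ^ k)"
      "integrable arc_length (\<lambda>\<zeta>. cnj (\<psi> \<zeta> * \<zeta> ^ k))"
      by (intro int continuous_intros cont)+
    show ?thesis
      unfolding integral_divide_zero Bochner_Integration.integral_add[OF i] Bochner_Integration.integral_cnj ..
  qed
  also have "(LINT \<zeta>|arc_length. \<psi> \<zeta> * \<zeta> ^ k) = 2 * pi * (if k = 0 then \<psi> 0 else 0)"
  proof -
    have "(\<lambda>\<zeta>. \<psi> \<zeta> * \<zeta> ^ k) holomorphic_on ball 0 r"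
      by (intro holomorphic_intros assms(1))
    from holomorphic_moment[OF this assms(2), of 0] show ?thesis
      by simp
  qed
  finally show ?thesis
    unfolding holomorphic_moment[OF assms] by (cases "k = 0") (simp add: complex_eq_iff, simp)
qed

text \<open>With \<open>w = cnj \<zeta> * z\<close> the kernel is \<open>2 / (1 - w) - 1\<close>, a
  geometric series; subtracting 1 explains why only the constant coefficient is 1 instead of
  2.\<close>

lemma herglotz_kernel_sums:
  assumes "norm \<zeta> = 1" "norm z < 1"
  shows "(\<lambda>n. (if n = 0 then 1 else 2) * (cnj \<zeta> ^ n * z ^ n)) sums ((\<zeta> + z) / (\<zeta> - z))"
proof -
  define w where "w = cnj \<zeta> * z"
  have w: "norm w < 1"
    using assms by (simp add: w_def norm_mult)
  have 1: "\<zeta> * cnj \<zeta> = 1"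
    using assms by (simp add: complex_norm_square[symmetric])
  have "(\<lambda>n. 2 * w ^ n - (if n = 0 then 1 else 0)) sums (2 * (1 / (1 - w)) - 1)"
    using sums_If_finite_set[of "{0::nat}" "\<lambda>_. 1::complex"]
    by (intro sums_diff sums_mult geometric_sums w) simp
  also have "(\<lambda>n. 2 * w ^ n - (if n = 0 then 1 else 0)) = (\<lambda>n. (if n = 0 then 1 else 2) * (cnj \<zeta> ^ n * z ^ n))"
    by (auto simp: w_def power_mult_distrib)
  also have "2 * (1 / (1 - w)) - 1 = (\<zeta> + z) / (\<zeta> - z)"
  proof -
    have "w \<noteq> 1" "\<zeta> \<noteq> z"
      using w assms by auto
    moreover have "\<zeta> * w = z"
      using 1 by (simp add: w_def mult.assoc[symmetric])
    ultimately show ?thesis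
      by (simp add: field_simps)
  qed
  finally show ?thesis .
qed

text \<open>Integrate the kernel series term by term, which the geometric majorant and the finite
  total mass permit, and compare coefficients. The moments of \<open>N\<close> can thus be read off
  from \<open>\<psi>\<close> alone, and \<open>c\<close> affects only the constant term.\<close>

lemma herglotz_moment:
  fixes \<psi> :: "complex \<Rightarrow> complex"
  assumes N: "finite_measure N" "sets N = sets circle_borel"
    and \<psi>: "\<And>z. norm z < 1 \<Longrightarrow> \<psi> z = \<i> * of_real c + (LINT \<zeta>|N. (\<zeta> + z) / (\<zeta> - z))"
  shows "(deriv ^^ k) \<psi> 0 / fact k =
    (if k = 0 then \<i> * of_real c + measure N (space N) else 2 * (LINT \<zeta>|N. cnj \<zeta> ^ k))"
proof -
  interpret finite_measure N by fact
  have sp: "space N = sphere 0 1"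
    using sets_eq_imp_space_eq[OF N(2)] by simp
  define a where "a n = (if n = 0 then 1 else 2) * (LINT \<zeta>|N. cnj \<zeta> ^ n)" for n :: nat
  have sums: "(\<lambda>n. a n * z ^ n) sums (LINT \<zeta>|N. (\<zeta> + z) / (\<zeta> - z))" if z: "norm z < 1" for z
  proof -
    let ?f = "\<lambda>n \<zeta>. (if n = 0 then 1 else 2) * (cnj \<zeta> ^ n * z ^ n)"
    have nf: "norm (?f n \<zeta>) \<le> 2 * norm z ^ n" if "\<zeta> \<in> sphere 0 1" for n \<zeta>
      using that by (simp add: norm_mult norm_power)
    have geo: "summable (\<lambda>n. 2 * norm z ^ n)"
      using z by (intro summable_mult summable_geometric) simp
    have int: "integrable N (?f n)" for n
      by (intro integrable_circle[OF N] continuous_intros)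
    have "(\<lambda>n. LINT \<zeta>|N. ?f n \<zeta>) sums (LINT \<zeta>|N. (\<Sum>n. ?f n \<zeta>))"
    proof (rule sums_integral[OF int])
      show "AE \<zeta> in N. summable (\<lambda>n. norm (?f n \<zeta>))"
        using nf sp by (intro AE_I2 summable_comparison_test'[OF geo]) auto
      have "norm (LINT \<zeta>|N. norm (?f n \<zeta>)) \<le> 2 * norm z ^ n * measure N (space N)" for n
      proof -
        have "(LINT \<zeta>|N. norm (?f n \<zeta>)) \<le> (LINT \<zeta>|N. 2 * norm z ^ n)"
          using nf sp int by (intro integral_mono) auto
        also have "\<dots> = 2 * norm z ^ n * measure N (space N)"
          by simp
        finally have "\<bar>LINT \<zeta>|N. norm (?f n \<zeta>)\<bar> \<le> 2 * norm z ^ n * measure N (space N)"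
          by (subst abs_of_nonneg) (auto intro!: integral_nonneg_AE)
        then show ?thesis
          by (simp only: real_norm_def)
      qed
      then show "summable (\<lambda>n. LINT \<zeta>|N. norm (?f n \<zeta>))"
        by (intro summable_comparison_test'[OF summable_mult2[OF geo, of "measure N (space N)"]])
    qed
    moreover have "(LINT \<zeta>|N. (\<Sum>n. ?f n \<zeta>)) = (LINT \<zeta>|N. (\<zeta> + z) / (\<zeta> - z))"
      using herglotz_kernel_sums[OF _ z] sp
      by (intro Bochner_Integration.integral_cong refl) (auto simp: sums_iff)
    moreover have "(\<lambda>n. LINT \<zeta>|N. ?f n \<zeta>) = (\<lambda>n. a n * z ^ n)"
      by (simp add: a_def fun_eq_iff)
    ultimately show ?thesis
      by (simp only:)
  qed
  have a0: "a 0 = measure N (space N)"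
    by (simp add: a_def scaleR_conv_of_real)
  define F where "F = Abs_fps (\<lambda>n. (if n = 0 then \<i> * of_real c else 0) + a n)"
  have "\<psi> has_fps_expansion F"
  proof (rule has_fps_expansionI)
    have "eventually (\<lambda>z::complex. z \<in> ball 0 1) (nhds 0)"
      by (intro eventually_nhds_in_open) auto
    then show "eventually (\<lambda>z. (\<lambda>n. fps_nth F n * z ^ n) sums \<psi> z) (nhds 0)"
    proof eventually_elim
      case (elim z)
      have "(\<lambda>n. (if n = 0 then \<i> * of_real c else 0) + a n * z ^ n) sums \<psi> z"
        unfolding \<psi>[of z, simplified, OF elim[simplified]]
        using sums_If_finite_set[of "{0::nat}" "\<lambda>_. \<i> * of_real c"] sums elim
        by (intro sums_add) simp_all
      also have "(\<lambda>n. (if n = 0 then \<i> * of_real c else 0) + a n * z ^ n) = (\<lambda>n. fps_nth F n * z ^ n)"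
        by (auto simp: F_def ring_distribs)
      finally show ?case .
    qed
  qed
  then have "(deriv ^^ k) \<psi> 0 / fact k = fps_nth F k"
    by (simp add: fps_nth_fps_expansion)
  then show ?thesis
    using a0 by (simp add: F_def a_def)
qed


text \<open>The monomials \<open>\<zeta>\<^sup>j cnj \<zeta>\<^sup>k\<close> are trigonometric monomials on the circle, and real polynomial functions
  of \<open>\<zeta>\<close> are polynomials in \<open>\<zeta>\<close> and \<open>cnj \<zeta>\<close>. Quantifying over the cofactor \<open>g\<close> makes the property stable under
  products.\<close>

lemma moments_determine_integral:
  fixes f :: "complex \<Rightarrow> real"
  assumes N: "finite_measure N" "sets N = sets circle_borel"
    and N': "finite_measure N'" "sets N' = sets circle_borel"
    and moments: "\<And>k. (LINT \<zeta>|N. cnj \<zeta> ^ k) = (LINT \<zeta>|N'. cnj \<zeta> ^ k)"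
    and f: "continuous_on (sphere 0 1) f"
  shows "(LINT \<zeta>|N. f \<zeta>) = (LINT \<zeta>|N'. f \<zeta>)"
proof -
  interpret N: finite_measure N by fact
  interpret N': finite_measure N' by fact
  have sp: "space N = sphere 0 1" "space N' = sphere 0 1"
    using sets_eq_imp_space_eq[OF N(2)] sets_eq_imp_space_eq[OF N'(2)] by simp_all
  note int = integrable_circle[OF N] integrable_circle[OF N']
  define E where "E g \<longleftrightarrow> (\<forall>j k. (LINT \<zeta>|N. \<zeta> ^ j * cnj \<zeta> ^ k * g \<zeta>) = (LINT \<zeta>|N'. \<zeta> ^ j * cnj \<zeta> ^ k * g \<zeta>))"
    for g :: "complex \<Rightarrow> complex"
  have E1: "E (\<lambda>_. 1)"
    unfolding E_def
  proof (intro allI)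
    fix j k
    \<comment> \<open>On the circle each monomial collapses to a single power. Powers of
      \<open>\<zeta>\<close> are written as conjugates of powers of \<open>cnj \<zeta>\<close>,
      since only the latter occur in \<open>moments\<close>; integration commutes with
      conjugation.\<close>
    have *: "\<zeta> ^ j * cnj \<zeta> ^ k * 1 = (if k \<le> j then cnj (cnj \<zeta> ^ (j - k)) else cnj \<zeta> ^ (k - j))"
      if "\<zeta> \<in> sphere 0 1" for \<zeta> :: complex
    proof -
      have 1: "\<zeta> ^ n * cnj \<zeta> ^ n = 1" for n
        using that by (simp add: complex_norm_square[symmetric] flip: power_mult_distrib)
      show ?thesis
      proof (cases "k \<le> j")
        case True
        then have "\<zeta> ^ j = \<zeta> ^ (j - k) * \<zeta> ^ k"
          by (simp flip: power_add)
        then show ?thesis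
          using True 1[of k] by (simp add: mult.assoc)
      next
        case False
        then have "cnj \<zeta> ^ k = cnj \<zeta> ^ j * cnj \<zeta> ^ (k - j)"
          by (simp flip: power_add)
        then show ?thesis
          using False 1[of j] by (simp add: mult.assoc[symmetric])
      qed
    qed
    have "(LINT \<zeta>|N. \<zeta> ^ j * cnj \<zeta> ^ k * 1) = (LINT \<zeta>|N. (if k \<le> j then cnj (cnj \<zeta> ^ (j - k)) else cnj \<zeta> ^ (k - j)))"
      by (rule Bochner_Integration.integral_cong[OF refl]) (use * sp in blast)
    also have "\<dots> = (LINT \<zeta>|N'. (if k \<le> j then cnj (cnj \<zeta> ^ (j - k)) else cnj \<zeta> ^ (k - j)))"
      by (cases "k \<le> j") (simp_all only: if_True if_False Bochner_Integration.integral_cnj moments)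
    also have "\<dots> = (LINT \<zeta>|N'. \<zeta> ^ j * cnj \<zeta> ^ k * 1)"
      by (rule Bochner_Integration.integral_cong[OF refl]) (use * sp in \<open>metis (no_types, lifting)\<close>)
    finally show "(LINT \<zeta>|N. \<zeta> ^ j * cnj \<zeta> ^ k * 1) = (LINT \<zeta>|N'. \<zeta> ^ j * cnj \<zeta> ^ k * 1)" .
  qed
  have poly: "E (\<lambda>\<zeta>. of_real (p \<zeta>) * g \<zeta>)"
    if "real_polynomial_function p" "continuous_on (sphere 0 1) g" "E g" for p g
    using that
  proof (induction arbitrary: g)
    case (linear p)
    interpret bounded_linear p by fact
    \<comment> \<open>A real linear form on the plane is a combination of \<open>\<zeta>\<close> and
      \<open>cnj \<zeta>\<close>; these coefficients are forced by its values at \<open>1\<close>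
      and \<open>\<i>\<close>.\<close>
    define a b where "a = (of_real (p 1) - \<i> * of_real (p \<i>)) / 2" and "b = (of_real (p 1) + \<i> * of_real (p \<i>)) / 2"
    have p: "of_real (p \<zeta>) = a * \<zeta> + b * cnj \<zeta>" for \<zeta>
    proof -
      have "p \<zeta> = p (Re \<zeta> *\<^sub>R 1 + Im \<zeta> *\<^sub>R \<i>)"
        by (rule arg_cong[of _ _ p]) (simp add: complex_eq_iff)
      also have "\<dots> = Re \<zeta> * p 1 + Im \<zeta> * p \<i>"
        by (simp only: add scale real_scaleR_def)
      finally show ?thesis
        by (simp add: a_def b_def complex_eq_iff field_simps)
    qed
    have split: "\<zeta> ^ j * cnj \<zeta> ^ k * (of_real (p \<zeta>) * g \<zeta>)
        = a * (\<zeta> ^ Suc j * cnj \<zeta> ^ k * g \<zeta>) + b * (\<zeta> ^ j * cnj \<zeta> ^ Suc k * g \<zeta>)" for j k \<zeta>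
      by (simp add: p algebra_simps)
    have i: "continuous_on (sphere 0 1) (\<lambda>\<zeta>. c * (\<zeta> ^ j * cnj \<zeta> ^ k * g \<zeta>))" for c j k
      by (intro continuous_intros linear.prems)
    show ?case
      unfolding E_def split Bochner_Integration.integral_add[OF int(1)[OF i] int(1)[OF i]]
        Bochner_Integration.integral_add[OF int(2)[OF i] int(2)[OF i]]
      using linear.prems(2) unfolding E_def by (simp del: power_Suc)
  next
    case (const c)
    then show ?case
      unfolding E_def by (simp add: mult.left_commute[of _ "of_real c"])
  next
    case (add p q)
    have c: "continuous_on (sphere 0 1) p" "continuous_on (sphere 0 1) q"
      using add.hyps continuous_on_polymonial_function real_polynomial_function_eq by blast+
    have i: "continuous_on (sphere 0 1) (\<lambda>\<zeta>. \<zeta> ^ j * cnj \<zeta> ^ k * (of_real (p \<zeta>) * g \<zeta>))"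
      "continuous_on (sphere 0 1) (\<lambda>\<zeta>. \<zeta> ^ j * cnj \<zeta> ^ k * (of_real (q \<zeta>) * g \<zeta>))" for j k
      by (intro continuous_intros add.prems c)+
    have split: "\<zeta> ^ j * cnj \<zeta> ^ k * (of_real (p \<zeta> + q \<zeta>) * g \<zeta>)
        = \<zeta> ^ j * cnj \<zeta> ^ k * (of_real (p \<zeta>) * g \<zeta>) + \<zeta> ^ j * cnj \<zeta> ^ k * (of_real (q \<zeta>) * g \<zeta>)" for j k \<zeta>
      by (simp add: algebra_simps)
    show ?case
      unfolding E_def split Bochner_Integration.integral_add[OF int(1)[OF i(1)] int(1)[OF i(2)]]
        Bochner_Integration.integral_add[OF int(2)[OF i(1)] int(2)[OF i(2)]]
      using add.IH[OF add.prems] unfolding E_def by simp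
  next
    case (mult p q)
    have "continuous_on (sphere 0 1) q"
      using mult.hyps continuous_on_polymonial_function real_polynomial_function_eq by blast
    then have "continuous_on (sphere 0 1) (\<lambda>\<zeta>. of_real (q \<zeta>) * g \<zeta>)"
      by (intro continuous_intros mult.prems)
    from mult.IH(1)[OF this mult.IH(2)[OF mult.prems]] show ?case
      by (simp add: mult.assoc)
  qed
  have poly_eq: "(LINT \<zeta>|N. p \<zeta>) = (LINT \<zeta>|N'. p \<zeta>)" if "real_polynomial_function p" for p
  proof -
    have "E (\<lambda>\<zeta>. of_real (p \<zeta>) * 1)"
      by (rule poly[OF that _ E1]) simp
    from this[unfolded E_def, rule_format, of 0 0] show ?thesis
      by simp
  qed
  have "\<bar>(LINT \<zeta>|N. f \<zeta>) - (LINT \<zeta>|N'. f \<zeta>)\<bar> \<le> e * (measure N (space N) + measure N' (space N'))"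
    if e: "0 < e" for e
  proof -
    obtain p where p: "real_polynomial_function p" "\<And>\<zeta>. \<zeta> \<in> sphere 0 1 \<Longrightarrow> \<bar>f \<zeta> - p \<zeta>\<bar> < e"
      using Stone_Weierstrass_real_polynomial_function[OF compact_sphere f e] by blast
    have cp: "continuous_on (sphere 0 1) p"
      using p(1) continuous_on_polymonial_function real_polynomial_function_eq by blast
    have bound: "\<bar>(LINT \<zeta>|M. f \<zeta>) - (LINT \<zeta>|M. p \<zeta>)\<bar> \<le> e * measure M (space M)"
      if M: "finite_measure M" "sets M = sets circle_borel" for M
    proof -
      interpret M: finite_measure M by fact
      have [simp]: "space M = sphere 0 1"
        using sets_eq_imp_space_eq[OF M(2)] by simp
      note i = integrable_circle[OF M]
      have "(LINT \<zeta>|M. f \<zeta>) - (LINT \<zeta>|M. p \<zeta>) = (LINT \<zeta>|M. f \<zeta> - p \<zeta>)"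
        by (rule Bochner_Integration.integral_diff[OF i[OF f] i[OF cp], symmetric])
      also have "\<bar>\<dots>\<bar> \<le> (LINT \<zeta>|M. e)"
        by (rule integral_abs_bound_integral)
          (use p(2) in \<open>auto intro!: i continuous_intros f cp less_imp_le\<close>)
      finally show ?thesis
        by (simp add: mult.commute)
    qed
    show ?thesis
      using bound[OF N] bound[OF N'] poly_eq[OF p(1)] by (simp add: ring_distribs)
  qed
  note small = this
  show ?thesis
  proof (rule ccontr)
    assume ne: "\<not> ?thesis"
    let ?d = "\<bar>(LINT \<zeta>|N. f \<zeta>) - (LINT \<zeta>|N'. f \<zeta>)\<bar>" and ?m = "measure N (space N) + measure N' (space N')"
    have m: "0 \<le> ?m"
      by simp
    \<comment> \<open>The tolerance is chosen so that its product with the total mass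
      \<open>?m\<close> is at most half of \<open>?d\<close>; the \<open>+ 1\<close> covers the case
      of zero mass.\<close>
    have "?d \<le> (?d / (?m + 1) / 2) * ?m"
      using ne m by (intro small) (simp add: add_nonneg_pos)
    also have "\<dots> = ?d * (?m / (?m + 1)) / 2"
      by simp
    also have "\<dots> \<le> ?d * 1 / 2"
    proof (intro divide_right_mono mult_left_mono)
      show "?m / (?m + 1) \<le> 1"
        using m by (subst divide_le_eq_1_pos) linarith+
    qed simp_all
    finally show False
      using ne by simp
  qed
qed

text \<open>The indicator of a nonempty closed set is the pointwise limit of the continuous
  functions \<open>max 0 (1 - real n * infdist \<zeta> C)\<close>, and closed sets form an
  intersection-stable generator of the Borel sets. The measures are transported to the plane by the
  identity so that this generator is available.\<close>

lemma measure_eqI_circle: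
  assumes N: "finite_measure N" "sets N = sets circle_borel"
    and N': "finite_measure N'" "sets N' = sets circle_borel"
    and eq: "\<And>f :: complex \<Rightarrow> real. continuous_on UNIV f \<Longrightarrow> (LINT \<zeta>|N. f \<zeta>) = (LINT \<zeta>|N'. f \<zeta>)"
    and B: "B \<in> sets circle_borel"
  shows "measure N B = measure N' B"
proof -
  have meas: "(\<lambda>\<zeta>. \<zeta>) \<in> M \<rightarrow>\<^sub>M borel" if "sets M = sets circle_borel" for M
    by (rule borel_measurable_circle[OF that]) (rule continuous_on_id)
  let ?D = "\<lambda>M. distr M borel (\<lambda>\<zeta>::complex. \<zeta>)"
  have fin: "finite_measure (?D N)" "finite_measure (?D N')"
    by (intro finite_measure.finite_measure_distr N N' meas)+
  have closed: "(\<lambda>n. LINT \<zeta>|M. max 0 (1 - real n * infdist \<zeta> C)) \<longlonglongrightarrow> measure (?D M) C"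
    if M: "finite_measure M" "sets M = sets circle_borel" and C: "closed C" "C \<noteq> {}" for M C
  proof -
    interpret finite_measure M by fact
    note [measurable_cong] = M(2)
    have "(\<lambda>n. LINT \<zeta>|M. max 0 (1 - real n * infdist \<zeta> C)) \<longlonglongrightarrow> (LINT \<zeta>|M. indicator C \<zeta>)"
    proof (rule integral_dominated_convergence[where w = "\<lambda>_. 1"])
      show "indicat_real C \<in> borel_measurable M"
        using C(1) by (intro measurable_compose[OF meas[OF M(2)] borel_measurable_indicator]) simp
      show "(\<lambda>\<zeta>. max 0 (1 - real n * infdist \<zeta> C)) \<in> borel_measurable M" for n
        by (intro borel_measurable_circle[OF M(2)] continuous_intros)
      show "AE \<zeta> in M. (\<lambda>n. max 0 (1 - real n * infdist \<zeta> C)) \<longlonglongrightarrow> indicat_real C \<zeta>"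
      proof (rule AE_I2)
        fix \<zeta>
        show "(\<lambda>n. max 0 (1 - real n * infdist \<zeta> C)) \<longlonglongrightarrow> indicat_real C \<zeta>"
        proof (cases "\<zeta> \<in> C")
          case False
          then have "0 < infdist \<zeta> C"
            using C by (metis in_closed_iff_infdist_zero infdist_nonneg less_eq_real_def)
          then obtain k :: nat where k: "1 < real k * infdist \<zeta> C"
            using reals_Archimedean3 by blast
          have "eventually (\<lambda>n. max 0 (1 - real n * infdist \<zeta> C) = 0) sequentially"
            using eventually_ge_at_top[of k]
          proof eventually_elim
            case (elim n)
            then have "real k * infdist \<zeta> C \<le> real n * infdist \<zeta> C"
              by (intro mult_right_mono) (auto simp: infdist_nonneg)
            then show ?case
              using k by simp
          qed
          then show ?thesis
            using False by (simp add: tendsto_eventually)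
        qed (simp add: infdist_zero)
      qed
      show "AE \<zeta> in M. norm (max 0 (1 - real n * infdist \<zeta> C)) \<le> 1" for n
        by (intro AE_I2) (simp add: infdist_nonneg)
    qed simp
    also have "(LINT \<zeta>|M. indicat_real C \<zeta>) = (LINT \<zeta>|?D M. indicat_real C \<zeta>)"
      using C(1) by (intro integral_distr[OF meas[OF M(2)], symmetric]) auto
    finally show ?thesis
      using C(1) by simp
  qed
  have "?D N = ?D N'"
  proof (rule measure_eqI_generator_eq[of "Collect closed" UNIV _ _ "\<lambda>_. UNIV"])
    fix C :: "complex set" assume "C \<in> Collect closed"
    then have C: "closed C"
      by simp
    \<comment> \<open>The empty set is treated separately because \<open>infdist\<close> to it is 0
      by convention, so that the approximating functions would be constantly 1.\<close>
    have "measure (?D N) C = measure (?D N') C"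
    proof (cases "C = {}")
      case False
      have "(LINT \<zeta>|N. max 0 (1 - real n * infdist \<zeta> C)) = (LINT \<zeta>|N'. max 0 (1 - real n * infdist \<zeta> C))" for n
        by (intro eq continuous_intros)
      then show ?thesis
        using closed[OF N C False] closed[OF N' C False] by (simp add: LIMSEQ_unique)
    qed simp
    then show "emeasure (?D N) C = emeasure (?D N') C"
      by (simp add: finite_measure.emeasure_eq_measure[OF fin(1)] finite_measure.emeasure_eq_measure[OF fin(2)])
  next
    show "Int_stable (Collect closed :: complex set set)"
      by (auto simp: Int_stable_def)
    show "emeasure (?D N) UNIV \<noteq> \<infinity>" for i :: nat
      by (simp add: finite_measure.emeasure_finite[OF fin(1)])
    show "sets (?D N) = sigma_sets UNIV (Collect closed)" "sets (?D N') = sigma_sets UNIV (Collect closed)"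
      by (simp_all add: borel_eq_closed)
  qed auto
  moreover have "measure (?D M) B = measure M B" if M: "sets M = sets circle_borel" for M
    using B sets_eq_imp_space_eq[OF M]
    by (subst measure_distr[OF meas[OF M]]) (auto simp: sets_circle_borel intro!: arg_cong[of _ _ "measure M"])
  ultimately show ?thesis
    using N(2) N'(2) by metis
qed

text \<open>The density \<open>Re (\<psi> \<zeta>) / (2 * pi)\<close> defines a finite measure with
  the same moments as \<open>N\<close>, so the two measures coincide.\<close>

lemma herglotz_density:
  fixes \<psi> :: "complex \<Rightarrow> complex"
  assumes N: "finite_measure N" "sets N = sets circle_borel"
    and \<psi>: "\<And>z. norm z < 1 \<Longrightarrow> \<psi> z = \<i> * of_real c + (LINT \<zeta>|N. (\<zeta> + z) / (\<zeta> - z))"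
    and hol: "\<psi> holomorphic_on ball 0 r" "r > 1"
    and nonneg: "\<And>z. norm z < 1 \<Longrightarrow> 0 \<le> Re (\<psi> z)"
    and B: "B \<in> sets circle_borel"
  shows "measure N B = (LINT \<zeta>:B|arc_length. Re (\<psi> \<zeta>)) / (2 * pi)"
proof -
  have "cball 0 1 \<subseteq> ball (0::complex) r"
    using hol(2) by auto
  then have cont: "continuous_on (cball 0 1) \<psi>"
    using hol(1) holomorphic_on_imp_continuous_on holomorphic_on_subset by blast
  then have cont': "continuous_on (sphere 0 1) \<psi>"
    by (rule continuous_on_subset) auto
  have cl: "closure (ball 0 1) = cball (0::complex) 1"
    by (rule closure_ball) simp
  \<comment> \<open>Non-negativity passes from the open disc to the circle by continuity; without it
    the density would be truncated.\<close>
  have pos: "0 \<le> Re (\<psi> \<zeta>)" if "\<zeta> \<in> sphere 0 1" for \<zeta>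
    using continuous_ge_on_closure[of "ball 0 1" "\<lambda>z. Re (\<psi> z)" \<zeta> 0] cont that nonneg
    unfolding cl by (auto intro!: continuous_intros)
  define h where "h \<zeta> = Re (\<psi> \<zeta>) / (2 * pi)" for \<zeta>
  have h: "continuous_on (sphere 0 1) h"
    unfolding h_def by (intro continuous_intros cont') auto
  have hm: "h \<in> borel_measurable arc_length"
    by (rule borel_measurable_circle[OF sets_arc_length h])
  have hpos: "AE \<zeta> in arc_length. 0 \<le> h \<zeta>"
    using pos by (intro AE_I2) (simp add: h_def)
  note int = integrable_circle[OF finite_measure_arc_length sets_arc_length]
  define D where "D = density arc_length h"
  have D: "sets D = sets circle_borel"
    by (simp add: D_def)
  have em: "emeasure D A = ennreal (LINT \<zeta>:A|arc_length. h \<zeta>)" if "A \<in> sets circle_borel" for A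
  proof -
    have i: "integrable arc_length (\<lambda>\<zeta>. indicat_real A \<zeta> * h \<zeta>)"
      using integrable_real_mult_indicator[OF _ int[OF h], of A] that by (simp add: mult.commute)
    have "emeasure D A = (\<integral>\<^sup>+ \<zeta>. ennreal (h \<zeta>) * indicator A \<zeta> \<partial>arc_length)"
      unfolding D_def using hm that by (intro emeasure_density) auto
    also have "\<dots> = (\<integral>\<^sup>+ \<zeta>. ennreal (indicat_real A \<zeta> * h \<zeta>) \<partial>arc_length)"
      by (intro nn_integral_cong) (simp split: split_indicator)
    also have "\<dots> = ennreal (LINT \<zeta>|arc_length. indicat_real A \<zeta> * h \<zeta>)"
      using hpos by (intro nn_integral_eq_integral[OF i]) (auto split: split_indicator)
    finally show ?thesis
      by (simp add: set_lebesgue_integral_def)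
  qed
  have finD: "finite_measure D"
    using em[of "space D"] D sets.top[of D] by (intro finite_measureI) auto
  have moments: "(LINT \<zeta>|N. cnj \<zeta> ^ k) = (LINT \<zeta>|D. cnj \<zeta> ^ k)" for k
  proof -
    have "(LINT \<zeta>|D. cnj \<zeta> ^ k) = (LINT \<zeta>|arc_length. h \<zeta> *\<^sub>R cnj \<zeta> ^ k)"
      unfolding D_def
      by (intro integral_density hm hpos borel_measurable_circle[OF sets_arc_length] continuous_intros)
    also have "\<dots> = (LINT \<zeta>|arc_length. Re (\<psi> \<zeta>) * cnj \<zeta> ^ k) / (2 * pi)"
      by (simp add: h_def scaleR_conv_of_real)
    \<comment> \<open>For \<open>k > 0\<close> the Taylor coefficient is twice the moment, and
      \<open>pi * 2\<close> cancels against \<open>2 * pi\<close>. For \<open>k = 0\<close> the real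
      part drops \<open>\<i> * of_real c\<close> and leaves the total mass.\<close>
    also have "\<dots> = (LINT \<zeta>|N. cnj \<zeta> ^ k)"
      unfolding Re_holomorphic_moment[OF hol]
      using herglotz_moment[OF N \<psi>, of k] \<psi>[of 0] by (auto simp: scaleR_conv_of_real)
    finally show ?thesis ..
  qed
  have "measure N B = measure D B"
    by (rule measure_eqI_circle[OF N finD D _ B])
      (auto intro!: moments_determine_integral[OF N finD D moments] elim: continuous_on_subset)
  also have "\<dots> = (LINT \<zeta>:B|arc_length. h \<zeta>)"
  proof -
    have "0 \<le> (LINT \<zeta>:B|arc_length. h \<zeta>)"
      unfolding set_lebesgue_integral_def using hpos
      by (intro integral_nonneg_AE) (auto split: split_indicator)
    then show ?thesis
      using em[OF B] by (simp add: measure_def)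
  qed
  also have "\<dots> = (LINT \<zeta>:B|arc_length. Re (\<psi> \<zeta>)) / (2 * pi)"
    by (simp add: h_def set_lebesgue_integral_def)
  finally show ?thesis .
qed

section \<open>Simple poles of rational functions\<close>

lemma higher_deriv_poly: "(deriv ^^ n) (poly p) = poly ((pderiv ^^ n) p)"
proof (induction n)
  case (Suc n)
  have "deriv (poly q) = poly (pderiv q)" for q :: "'a poly"
    by (intro ext DERIV_imp_deriv poly_DERIV)
  then show ?case
    using Suc by simp
qed simp

text \<open>At \<open>u\<close> only the Leibniz term survives in which every derivative hits the
  power. The induction varies \<open>h\<close> because one derivative again yields a power times a
  cofactor.\<close>

lemma poly_higher_pderiv_power_mult:
  "poly ((pderiv ^^ n) ([:- u, 1:] ^ n * h)) u = fact n * poly h u"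
  for u :: "'a::{idom, semiring_char_0}"
proof (induction n arbitrary: h)
  case (Suc n)
  have *: "pderiv (x ^ Suc n * h) = x ^ n * (smult (of_nat (Suc n)) h + x * pderiv h)" if "pderiv x = 1" for x
  proof -
    have "pderiv (x ^ Suc n) = smult (of_nat (Suc n)) (x ^ n)"
      using pderiv_power_Suc[of x n] that by simp
    then show ?thesis
      by (simp only: pderiv_mult) (simp add: algebra_simps)
  qed
  have "pderiv ([:- u, 1:] ^ Suc n * h) = [:- u, 1:] ^ n * (smult (of_nat (Suc n)) h + [:- u, 1:] * pderiv h)"
    by (rule *) (simp add: pderiv_pCons)
  then show ?case
    by (simp add: funpow_swap1[symmetric] Suc del: of_nat_Suc power_Suc funpow.simps add: funpow_Suc_right)
qed simp

text \<open>A finite limit along a single sequence suffices: a rational function with a pole of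
  order at least 2 would be unbounded along it even after multiplication by \<open>u - z n\<close>.
  The exponents refer to the multiplicity in \<open>d\<close>, so \<open>g'\<close> may still vanish
  at \<open>u\<close>. The minus sign in \<open>L\<close> stems from using \<open>u - z n\<close>
  rather than \<open>z n - u\<close>.\<close>

lemma simple_pole_decomposition:
  fixes g d :: "complex poly"
  assumes d: "d \<noteq> 0" "poly d u = 0"
    and z: "z \<longlonglongrightarrow> u" "\<And>n. z n \<noteq> u"
    and L: "(\<lambda>n. (u - z n) * (poly g (z n) / poly d (z n))) \<longlonglongrightarrow> L"
  obtains g' d' where "d = [:- u, 1:] ^ order u d * d'" "g = [:- u, 1:] ^ (order u d - 1) * g'"
    "poly d' u \<noteq> 0" "L = - poly g' u / poly d' u"
proof -
  let ?x = "[:- u, 1:]" and ?m = "order u d"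
  have m: "0 < ?m"
    using d by (simp add: order_root)
  obtain d' where d': "d = ?x ^ ?m * d'" "\<not> ?x dvd d'"
    using order_decomp[OF d(1)] by blast
  then have d'u: "poly d' u \<noteq> 0"
    by (simp add: poly_eq_0_iff_dvd)
  have lim: "(\<lambda>n. poly p (z n)) \<longlonglongrightarrow> poly p u" for p
    using z(1) by (intro tendsto_intros)
  have "?x ^ (?m - 1) dvd g"
  proof (cases "g = 0")
    case False
    define k where "k = order u g"
    obtain h where h: "g = ?x ^ k * h" "\<not> ?x dvd h"
      using order_decomp[OF False] k_def by blast
    then have hu: "poly h u \<noteq> 0"
      by (simp add: poly_eq_0_iff_dvd)
    have "?m - 1 \<le> k"
    proof (rule ccontr)
      assume "\<not> ?m - 1 \<le> k"
      then have l: "?m = k + 1 + (?m - k - 1)" "0 < ?m - k - 1"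
        by auto
      \<comment> \<open>Multiplying by the surplus power leaves a quotient with nonzero limit,
        whereas the positive exponent makes the product tend to 0.\<close>
      have "(u - z n) * (poly g (z n) / poly d (z n)) * (z n - u) ^ (?m - k - 1)
          = - (poly h (z n) / poly d' (z n))" for n
      proof -
        define a where "a = z n - u"
        have a: "a \<noteq> 0" "u - z n = - a"
          using z(2) by (auto simp: a_def)
        have "poly d (z n) = a ^ ?m * poly d' (z n)"
          by (subst d') (simp add: a_def)
        also have "a ^ ?m = a ^ k * a * a ^ (?m - k - 1)"
          using arg_cong[OF l(1), of "\<lambda>j. a ^ j"] by (simp only: power_add power_one_right)
        finally have "poly d (z n) = a ^ k * a * a ^ (?m - k - 1) * poly d' (z n)" .
        moreover have "poly g (z n) = a ^ k * poly h (z n)"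
          by (simp add: h(1) a_def)
        ultimately show ?thesis
          using a(1) unfolding a(2) a_def[symmetric] by simp
      qed
      moreover have "(\<lambda>n. (u - z n) * (poly g (z n) / poly d (z n)) * (z n - u) ^ (?m - k - 1))
          \<longlonglongrightarrow> L * (u - u) ^ (?m - k - 1)"
        by (intro tendsto_intros L z)
      moreover have "L * (u - u) ^ (?m - k - 1) = 0"
        using l(2) by (simp add: zero_power)
      ultimately have "(\<lambda>n. - (poly h (z n) / poly d' (z n))) \<longlonglongrightarrow> 0"
        by (simp only:)
      moreover have "(\<lambda>n. - (poly h (z n) / poly d' (z n))) \<longlonglongrightarrow> - (poly h u / poly d' u)"
        by (intro tendsto_intros lim d'u)
      ultimately show False
        using hu d'u LIMSEQ_unique by fastforce
    qed
    then show ?thesis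
      unfolding h(1) by (intro dvd_mult2 le_imp_power_dvd)
  qed simp
  then obtain g' where g': "g = ?x ^ (?m - 1) * g'"
    by (auto elim: dvdE)
  have "(u - z n) * (poly g (z n) / poly d (z n)) = - poly g' (z n) / poly d' (z n)" for n
  proof -
    define a where "a = z n - u"
    have a: "a \<noteq> 0" "u - z n = - a"
      using z(2) by (auto simp: a_def)
    have "poly d (z n) = a ^ (?m - 1) * a * poly d' (z n)"
      using m by (subst d') (simp add: a_def flip: power_Suc2)
    moreover have "poly g (z n) = a ^ (?m - 1) * poly g' (z n)"
      by (subst g') (simp add: a_def)
    ultimately show ?thesis
      using a(1) unfolding a(2) by simp
  qed
  then have "(\<lambda>n. - poly g' (z n) / poly d' (z n)) \<longlonglongrightarrow> L"
    using L by simp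
  moreover have "(\<lambda>n. - poly g' (z n) / poly d' (z n)) \<longlonglongrightarrow> - poly g' u / poly d' u"
    by (intro tendsto_intros lim d'u)
  ultimately have "L = - poly g' u / poly d' u"
    by (rule LIMSEQ_unique)
  then show ?thesis
    using that d'(1) g' d'u by blast
qed

lemma eventually_poly_nonzero:
  fixes p :: "'a::{idom, t1_space} poly"
  assumes "p \<noteq> 0"
  shows "eventually (\<lambda>z. poly p z \<noteq> 0) (at u)"
proof -
  have "open (- ({z. poly p z = 0} - {u}))"
    using poly_roots_finite[OF assms] by (intro open_Compl finite_imp_closed) simp
  then have "eventually (\<lambda>z. z \<in> - ({z. poly p z = 0} - {u})) (at u)"
    by (intro eventually_at_in_open') auto
  moreover have "eventually (\<lambda>z. z \<noteq> u) (at u)"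
    by (simp add: eventually_at_filter)
  ultimately show ?thesis
    by eventually_elim auto
qed

lemma analytic_at_tendsto_quotient:
  fixes f :: "complex \<Rightarrow> complex"
  assumes "f analytic_on {u}" "f u = 0"
  shows "((\<lambda>z. f z / (z - u)) \<longlongrightarrow> deriv f u) (at u)"
  using assms analytic_on_imp_differentiable_at[OF assms(1), of u]
    DERIV_deriv_iff_field_differentiable[of f u] by (simp add: has_field_derivative_iff)

section \<open>Quotients of matrix polynomials as entrywise rational functions\<close>

text \<open>Evaluation is a ring homomorphism and commutes with determinants; this turns the entries
  of \<open>P ** adjugate Q\<close> into polynomials, whose multiplicities can be counted.\<close>

lemma adjugate_poly_mat: "adjugate (poly_mat Q z) $ i $ j = poly (adjugate Q $ i $ j) z"
proof -
  have "poly_mat (\<chi> k l. if l = i then axis j 1 $ k else Q $ k $ l) z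
      = (\<chi> k l. if l = i then axis j 1 $ k else poly_mat Q z $ k $ l)"
    by (simp add: poly_mat_def map_matrix_def vec_eq_iff axis_def)
  then show ?thesis
    by (simp add: adjugate_def poly_det)
qed

lemma poly_mat_mult_adjugate:
  "(poly_mat P z ** adjugate (poly_mat Q z)) $ i $ j = poly ((P ** adjugate Q) $ i $ j) z"
  by (simp add: matrix_matrix_mult_def adjugate_poly_mat poly_sum)
    (simp add: poly_mat_def map_matrix_def)

lemma matrix_inv_adjugate:
  fixes A :: "complex^'n^'n"
  assumes "det A \<noteq> 0"
  shows "matrix_inv A = map_matrix ((*) (1 / det A)) (adjugate A)"
proof -
  let ?B = "map_matrix ((*) (1 / det A)) (adjugate A)"
  have "(?B ** A) $ i $ j = mat 1 $ i $ j" for i j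
  proof -
    have "(?B ** A) $ i $ j = (1 / det A) * (adjugate A ** A) $ i $ j"
      by (simp add: matrix_matrix_mult_def map_matrix_def sum_divide_distrib)
    then show ?thesis
      using assms by (simp add: adjugate_mult_left mat_def)
  qed
  then have B: "?B ** A = mat 1"
    by (simp add: vec_eq_iff)
  then have "A ** ?B = mat 1"
    by (simp add: matrix_left_right_inverse)
  with B have "A ** matrix_inv A = mat 1"
    unfolding matrix_inv_def using someI[of "\<lambda>A'. A ** A' = mat 1 \<and> A' ** A = mat 1" ?B] by blast
  then have "matrix_inv A = (?B ** A) ** matrix_inv A"
    by (simp add: B)
  also have "\<dots> = ?B ** (A ** matrix_inv A)"
    by (rule matrix_mul_assoc[symmetric])
  finally show ?thesis
    using \<open>A ** matrix_inv A = mat 1\<close> by simp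
qed

lemma poly_mat_quotient:
  assumes "poly (det Q) z \<noteq> 0"
  shows "(poly_mat P z ** matrix_inv (poly_mat Q z)) $ i $ j = poly ((P ** adjugate Q) $ i $ j) z / poly (det Q) z"
proof -
  have "(poly_mat P z ** matrix_inv (poly_mat Q z)) $ i $ j
      = (poly_mat P z ** adjugate (poly_mat Q z)) $ i $ j / poly (det Q) z"
    using assms unfolding poly_det
    by (simp add: matrix_inv_adjugate matrix_matrix_mult_def map_matrix_def sum_divide_distrib)
  then show ?thesis
    by (simp add: poly_mat_mult_adjugate)
qed

lemma poly_analytic: "poly p analytic_on A" for p :: "complex poly"
proof -
  have "poly p holomorphic_on UNIV"
    by (auto simp: holomorphic_on_def field_differentiable_def intro: poly_DERIV)
  then show ?thesis
    using analytic_on_open analytic_on_subset by blast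
qed

lemma open_poly_nonzero: "open {z::complex. poly p z \<noteq> 0}"
  by (intro open_Collect_neq continuous_intros)

text \<open>Where \<open>det Q\<close> does not vanish the quotient is already analytic, so the
  removal of singularities changes neither its value nor its analyticity.\<close>

lemma
  assumes "poly (det Q) z \<noteq> 0"
  shows mat_quotient_eq: "mat_quotient P Q z $ i $ j = poly ((P ** adjugate Q) $ i $ j) z / poly (det Q) z"
    and mat_quotient_analytic: "(\<lambda>w. mat_quotient P Q w $ i $ j) analytic_on {z}"
proof -
  let ?f = "\<lambda>w. (poly_mat P w ** matrix_inv (poly_mat Q w)) $ i $ j"
  let ?g = "\<lambda>w. poly ((P ** adjugate Q) $ i $ j) w / poly (det Q) w"
  have ev: "eventually (\<lambda>w. ?f w = ?g w) (nhds z)"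
    using eventually_nhds_in_open[OF open_poly_nonzero, of z "det Q"] assms
    by (auto elim: eventually_mono simp: poly_mat_quotient)
  have "?g analytic_on {z}"
    using assms by (intro analytic_on_divide poly_analytic) auto
  then have f: "?f analytic_on {z}"
    using analytic_at_cong[OF ev refl] by simp
  then show "mat_quotient P Q z $ i $ j = ?g z"
    using assms by (simp add: mat_quotient_def remove_sings_mat_def poly_mat_quotient)
  show "(\<lambda>w. mat_quotient P Q w $ i $ j) analytic_on {z}"
    using remove_sings_analytic_on[OF f] by (simp add: mat_quotient_def remove_sings_mat_def)
qed

section \<open>Atoms of a finite measure on the unit circle\<close>

lemma kernel_denominator:
  fixes \<zeta> z :: complex
  assumes "norm \<zeta> = 1" "norm z < 1"
  shows "1 - norm z \<le> norm (\<zeta> - z)" "\<zeta> \<noteq> z" "norm ((\<zeta> + z) / (\<zeta> - z)) \<le> 2 / (1 - norm z)"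
proof -
  show 1: "1 - norm z \<le> norm (\<zeta> - z)"
    using norm_triangle_ineq2[of \<zeta> z] assms by simp
  show "\<zeta> \<noteq> z"
    using assms by auto
  have "norm (\<zeta> + z) \<le> 2"
    using norm_triangle_ineq[of \<zeta> z] assms by simp
  then show "norm ((\<zeta> + z) / (\<zeta> - z)) \<le> 2 / (1 - norm z)"
    unfolding norm_divide using 1 assms by (intro frac_le) auto
qed

text \<open>The real part is the Poisson kernel
  \<open>(1 - (norm z)\<^sup>2) / (norm (\<zeta> - z))\<^sup>2\<close>.\<close>

lemma Re_kernel_nonneg:
  assumes "norm \<zeta> = 1" "norm z < 1"
  shows "0 \<le> Re ((\<zeta> + z) / (\<zeta> - z))"
proof -
  have "Re ((\<zeta> + z) * cnj (\<zeta> - z)) = (norm \<zeta>)\<^sup>2 - (norm z)\<^sup>2"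
    unfolding cmod_power2 by (simp add: power2_eq_square algebra_simps)
  then have "Re ((\<zeta> + z) * cnj (\<zeta> - z)) = 1 - (norm z)\<^sup>2"
    using assms by simp
  moreover have "(norm z)\<^sup>2 \<le> 1"
    using assms by (simp add: power_le_one)
  moreover have "(\<zeta> + z) / (\<zeta> - z) = ((\<zeta> + z) * cnj (\<zeta> - z)) / of_real ((norm (\<zeta> - z))\<^sup>2)"
    by (rule complex_div_cnj)
  ultimately show ?thesis
    by (simp add: Re_divide_of_real)
qed

lemma integrable_kernel:
  assumes "finite_measure N" "sets N = sets circle_borel" "norm z < 1"
  shows "integrable N (\<lambda>\<zeta>. (\<zeta> + z) / (\<zeta> - z))"
  using kernel_denominator(2)[OF _ assms(3)]
  by (intro integrable_circle[OF assms(1,2)] continuous_intros) auto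

text \<open>Dominated convergence: the integrand tends to \<open>2 * u\<close> at
  \<open>\<zeta> = u\<close> and to 0 elsewhere. The kernel is at most \<open>2 / (1 - s n)\<close>
  in norm while the prefactor has norm exactly \<open>1 - s n\<close>, whence the majorant
  2.\<close>

lemma herglotz_radial_limit:
  assumes N: "finite_measure N" "sets N = sets circle_borel"
    and u: "u \<in> sphere 0 1" and s: "\<And>n. 0 \<le> s n" "\<And>n. s n < 1" "s \<longlonglongrightarrow> 1"
  shows "(\<lambda>n. (u - of_real (s n) * u) * (LINT \<zeta>|N. (\<zeta> + of_real (s n) * u) / (\<zeta> - of_real (s n) * u)))
    \<longlonglongrightarrow> 2 * u * measure N {u}"
proof -
  interpret finite_measure N by fact
  have sp: "space N = sphere 0 1"
    using sets_eq_imp_space_eq[OF N(2)] by simp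
  have u1: "norm u = 1" and uN: "{u} \<in> sets N"
    using u by (auto simp: N(2) sets_circle_borel)
  define z where "z n = of_real (s n) * u" for n
  have nz: "norm (z n) = s n" for n
    using s(1) u1 by (simp add: z_def norm_mult)
  have lim: "z \<longlonglongrightarrow> u"
    unfolding z_def using tendsto_mult_right[OF tendsto_of_real[OF s(3)], of u] by simp
  have "(\<lambda>n. LINT \<zeta>|N. (u - z n) * ((\<zeta> + z n) / (\<zeta> - z n))) \<longlonglongrightarrow> (LINT \<zeta>|N. 2 * u * of_real (indicat_real {u} \<zeta>))"
  proof (rule integral_dominated_convergence[where w = "\<lambda>_. 2"])
    show "AE \<zeta> in N. (\<lambda>n. (u - z n) * ((\<zeta> + z n) / (\<zeta> - z n))) \<longlonglongrightarrow> 2 * u * of_real (indicat_real {u} \<zeta>)"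
    proof (rule AE_I2)
      fix \<zeta> assume "\<zeta> \<in> space N"
      show "(\<lambda>n. (u - z n) * ((\<zeta> + z n) / (\<zeta> - z n))) \<longlonglongrightarrow> 2 * u * of_real (indicat_real {u} \<zeta>)"
      proof (cases "\<zeta> = u")
        case True
        have "(u - z n) * ((\<zeta> + z n) / (\<zeta> - z n)) = u + z n" for n
          using kernel_denominator(2)[OF u1, of "z n"] s(2)[of n] True nz by simp
        then show ?thesis
          using tendsto_add[OF tendsto_const[of u] lim] True by simp
      next
        case False
        have "(\<lambda>n. (u - z n) * ((\<zeta> + z n) / (\<zeta> - z n))) \<longlonglongrightarrow> (u - u) * ((\<zeta> + u) / (\<zeta> - u))"
          using False by (intro tendsto_intros lim) simp
        then show ?thesis
          using False by simp
      qed
    qed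
    show "AE \<zeta> in N. norm ((u - z n) * ((\<zeta> + z n) / (\<zeta> - z n))) \<le> 2" for n
    proof (rule AE_I2)
      fix \<zeta> assume "\<zeta> \<in> space N"
      then have \<zeta>: "norm \<zeta> = 1"
        using sp by simp
      have "u - z n = of_real (1 - s n) * u"
        by (simp add: z_def algebra_simps)
      then have "norm (u - z n) = 1 - s n"
        using s(2)[of n] u1 by (simp only: norm_mult norm_of_real) simp
      then have "norm ((u - z n) * ((\<zeta> + z n) / (\<zeta> - z n))) \<le> (1 - s n) * (2 / (1 - s n))"
        unfolding norm_mult
        using kernel_denominator(3)[OF \<zeta>, of "z n"] s(2)[of n] by (intro mult_mono) (auto simp: nz)
      also have "(1 - s n) * (2 / (1 - s n)) = 2"
        using s(2)[of n] by (simp add: field_simps)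
      finally show "norm ((u - z n) * ((\<zeta> + z n) / (\<zeta> - z n))) \<le> 2" .
    qed
    show "(\<lambda>\<zeta>. (u - z n) * ((\<zeta> + z n) / (\<zeta> - z n))) \<in> borel_measurable N" for n
      by (intro borel_measurable_integrable integrable_mult_right integrable_kernel N) (simp add: nz s)
    show "(\<lambda>\<zeta>. 2 * u * of_real (indicat_real {u} \<zeta>)) \<in> borel_measurable N"
      using uN by measurable
  qed simp
  then show ?thesis
    unfolding integral_mult_right_zero integral_of_real z_def using u sp by simp
qed

lemma integral_split_atoms:
  fixes f :: "complex \<Rightarrow> complex"
  assumes N: "finite_measure N" "sets N = sets circle_borel"
    and S: "finite S" "S \<subseteq> sphere 0 1" and f: "integrable N f"
  shows "(LINT \<zeta>|N. f \<zeta>) = (LINT \<zeta>|density N (indicator (- S)). f \<zeta>) + (\<Sum>u\<in>S. f u * measure N {u})"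
proof -
  interpret finite_measure N by fact
  have atom: "{u} \<in> sets N" if "u \<in> S" for u
    using that S by (auto simp: N(2) sets_circle_borel)
  have co: "- S \<inter> space N \<in> sets N"
    using S sets_eq_imp_space_eq[OF N(2)]
    by (auto simp: N(2) sets_circle_borel finite_imp_closed intro!: sets.Int)
  have ind: "indicat_real (- S) \<in> borel_measurable N"
    using co by (subst borel_measurable_indicator_iff)
  have i: "integrable N (\<lambda>\<zeta>. indicat_real (- S) \<zeta> *\<^sub>R f \<zeta>)"
    using integrable_mult_indicator[OF co f]
    by (rule Bochner_Integration.integrable_cong[THEN iffD1, rotated 2]) (auto split: split_indicator)
  have atoms: "has_bochner_integral N (\<lambda>\<zeta>. indicat_real {u} \<zeta> *\<^sub>R f u) (measure N {u} *\<^sub>R f u)" if "u \<in> S" for u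
    by (rule has_bochner_integral_indicator[OF atom[OF that]]) (simp add: less_top[symmetric])
  have "f \<zeta> = indicat_real (- S) \<zeta> *\<^sub>R f \<zeta> + (\<Sum>u\<in>S. indicat_real {u} \<zeta> *\<^sub>R f u)" for \<zeta>
  proof -
    have "(\<Sum>u\<in>S. indicat_real {u} \<zeta> *\<^sub>R f u) = (\<Sum>u\<in>S. if u = \<zeta> then f u else 0)"
      by (intro sum.cong) (auto simp: indicator_def)
    then show ?thesis
      using S(1) by (simp add: indicator_def)
  qed
  then have "(LINT \<zeta>|N. f \<zeta>) = (LINT \<zeta>|N. indicat_real (- S) \<zeta> *\<^sub>R f \<zeta> + (\<Sum>u\<in>S. indicat_real {u} \<zeta> *\<^sub>R f u))"
    by (rule Bochner_Integration.integral_cong[OF refl])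
  also have "\<dots> = (LINT \<zeta>|N. indicat_real (- S) \<zeta> *\<^sub>R f \<zeta>) + (LINT \<zeta>|N. (\<Sum>u\<in>S. indicat_real {u} \<zeta> *\<^sub>R f u))"
    using atoms by (intro Bochner_Integration.integral_add i Bochner_Integration.integrable_sum)
      (auto simp: has_bochner_integral_iff)
  also have "(LINT \<zeta>|N. (\<Sum>u\<in>S. indicat_real {u} \<zeta> *\<^sub>R f u)) = (\<Sum>u\<in>S. f u * measure N {u})"
    using has_bochner_integral_sum[of S N, OF atoms]
    by (simp add: has_bochner_integral_iff scaleR_conv_of_real mult.commute)
  also have "(LINT \<zeta>|N. indicat_real (- S) \<zeta> *\<^sub>R f \<zeta>) = (LINT \<zeta>|density N (\<lambda>\<zeta>. ennreal (indicat_real (- S) \<zeta>)). f \<zeta>)"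
    by (rule integral_density[symmetric]) (use f ind in auto)
  finally show ?thesis
    by (simp add: ennreal_indicator)
qed

lemma finite_measure_density_indicator:
  assumes "finite_measure N" "A \<inter> space N \<in> sets N"
  shows "finite_measure (density N (indicator A))"
proof (rule finite_measureI)
  interpret finite_measure N by fact
  have "indicat_real A \<in> borel_measurable N"
    using assms(2) by (subst borel_measurable_indicator_iff)
  then have "(\<lambda>x. ennreal (indicat_real A x)) \<in> borel_measurable N"
    by simp
  then have [measurable]: "(indicator A :: _ \<Rightarrow> ennreal) \<in> borel_measurable N"
    by (simp add: ennreal_indicator)
  have "emeasure (density N (indicator A)) (space N) = (\<integral>\<^sup>+ x. indicator A x * indicator (space N) x \<partial>N)"
    by (intro emeasure_density) auto
  also have "\<dots> \<le> (\<integral>\<^sup>+ x. 1 \<partial>N)"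
    by (intro nn_integral_mono) (simp add: indicator_def)
  finally show "emeasure (density N (indicator A)) (space (density N (indicator A))) \<noteq> \<infinity>"
    using emeasure_finite[of "space N"] by (auto simp: top_unique)
qed

lemma measure_split_atoms:
  assumes N: "finite_measure N" "sets N = sets circle_borel"
    and S: "finite S" "S \<subseteq> sphere 0 1" and B: "B \<in> sets circle_borel"
  shows "measure N B = measure (density N (indicator (- S))) B + (\<Sum>u\<in>S. indicator B u * measure N {u})"
proof -
  interpret finite_measure N by fact
  let ?f = "\<lambda>\<zeta>. complex_of_real (indicator B \<zeta>)"
  have "B \<in> sets N"
    using N(2) B by simp
  then have BN: "B \<inter> space N = B" and "integrable N ?f"
    using sets.sets_into_space by (auto simp: emeasure_eq_measure)
  from integral_split_atoms[OF N S this(2)]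
  have "complex_of_real (measure N B)
      = of_real (measure (density N (indicator (- S))) B + (\<Sum>u\<in>S. indicator B u * measure N {u}))"
    by (simp add: BN)
  then show ?thesis
    by (simp only: of_real_eq_iff)
qed

section \<open>Rational scalar functions\<close>

text \<open>The scalar condition inside \<open>rational_mat\<close>. Values at zeros of
  \<open>q\<close> are free, so enlarging the denominator only weakens the demand.\<close>

definition rational_fun :: "(complex \<Rightarrow> complex) \<Rightarrow> bool"
  where "rational_fun f \<longleftrightarrow> (\<exists>p q. q \<noteq> 0 \<and> (\<forall>z. poly q z \<noteq> 0 \<longrightarrow> f z = poly p z / poly q z))"

lemma rational_funI:
  "q \<noteq> 0 \<Longrightarrow> (\<And>z. poly q z \<noteq> 0 \<Longrightarrow> f z = poly p z / poly q z) \<Longrightarrow> rational_fun f"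
  by (auto simp: rational_fun_def)

lemma rational_fun_add:
  assumes "rational_fun f" "rational_fun g"
  shows "rational_fun (\<lambda>z. f z + g z)"
proof -
  obtain p q where f: "q \<noteq> 0" "\<And>z. poly q z \<noteq> 0 \<Longrightarrow> f z = poly p z / poly q z"
    using assms(1) by (auto simp: rational_fun_def)
  obtain p' q' where g: "q' \<noteq> 0" "\<And>z. poly q' z \<noteq> 0 \<Longrightarrow> g z = poly p' z / poly q' z"
    using assms(2) by (auto simp: rational_fun_def)
  show ?thesis
    by (rule rational_funI[of "q * q'" _ "p * q' + p' * q"]) (auto simp: f g field_simps)
qed

lemma rational_fun_cmult:
  assumes "rational_fun f"
  shows "rational_fun (\<lambda>z. c * f z)"
proof -
  obtain p q where f: "q \<noteq> 0" "\<And>z. poly q z \<noteq> 0 \<Longrightarrow> f z = poly p z / poly q z"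
    using assms(1) by (auto simp: rational_fun_def)
  then show ?thesis
    by (intro rational_funI[of q _ "smult c p"]) auto
qed

lemma rational_fun_sum:
  assumes "finite S" "\<And>x. x \<in> S \<Longrightarrow> rational_fun (f x)"
  shows "rational_fun (\<lambda>z. \<Sum>x\<in>S. f x z)"
  using assms
proof (induction S)
  case empty
  show ?case
    by (rule rational_funI[of "[:1:]" _ 0]) auto
next
  case (insert x S)
  then show ?case
    by (simp add: rational_fun_add)
qed

text \<open>Multiplying numerator and denominator by \<open>d\<close> exempts the zeros of
  \<open>d\<close>, where the two functions may differ.\<close>

lemma rational_fun_transform:
  assumes "rational_fun f" "d \<noteq> 0" "\<And>z. poly d z \<noteq> 0 \<Longrightarrow> g z = f z"
  shows "rational_fun g"
proof -
  obtain p q where f: "q \<noteq> 0" "\<And>z. poly q z \<noteq> 0 \<Longrightarrow> f z = poly p z / poly q z"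
    using assms(1) by (auto simp: rational_fun_def)
  then show ?thesis
    using assms(2,3) by (intro rational_funI[of "q * d" _ "p * d"]) auto
qed

section \<open>Separation of the atoms\<close>

lemma singular_part_entry:
  "singular_part P Q z $ i $ j = (\<Sum>u\<in>circle_zeros Q. (u + z) / (u - z) * residue_weight P Q u $ i $ j)"
  by (simp add: singular_part_def map_matrix_def)

lemma quad_singular_part:
  "quad v (singular_part P Q z) = (\<Sum>u\<in>circle_zeros Q. (u + z) / (u - z) * quad v (residue_weight P Q u))"
  by (simp add: singular_part_def quad_sum quad_scale)

lemma circle_zeros_iff: "u \<in> circle_zeros Q \<longleftrightarrow> norm u = 1 \<and> poly (det Q) u = 0"
  by (simp add: circle_zeros_def poly_det)

context
  fixes P Q :: "complex poly^'q^'q" and \<mu> :: "complex set \<Rightarrow> complex^'q^'q"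
  assumes det_Q: "det Q \<noteq> 0"
    and car: "caratheodory (mat_quotient P Q)"
    and herglotz: "riesz_herglotz_measure (mat_quotient P Q) \<mu>"
begin

lemma finite_circle_zeros: "finite (circle_zeros Q)"
  by (rule finite_subset[OF _ poly_roots_finite[OF det_Q]]) (auto simp: circle_zeros_iff)

lemma circle_zeros_subset: "circle_zeros Q \<subseteq> sphere 0 1"
  by (auto simp: circle_zeros_def)

lemma nonneg_hermitian_measure_\<mu>: "nonneg_hermitian_measure \<mu>"
  using herglotz by (simp add: riesz_herglotz_measure_def)

lemma order_pos: "u \<in> circle_zeros Q \<Longrightarrow> 0 < order u (det Q)"
  using det_Q by (auto simp: circle_zeros_iff order_root)

lemma quad_herglotz:
  assumes z: "norm z < 1"
  shows "quad v (mat_quotient P Q z) = \<i> * of_real (Im (quad v (mat_quotient P Q 0)))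
    + (LINT \<zeta>|quad_measure \<mu> v. (\<zeta> + z) / (\<zeta> - z))"
proof -
  have "mat_quotient P Q z - map_matrix ((*) \<i>) (Im_mat (mat_quotient P Q 0))
      = matrix_measure_integral \<mu> (\<lambda>\<zeta>. (\<zeta> + z) / (\<zeta> - z))"
    using herglotz z by (simp add: riesz_herglotz_measure_def)
  then have "quad v (mat_quotient P Q z) - \<i> * of_real (Im (quad v (mat_quotient P Q 0)))
      = quad v (matrix_measure_integral \<mu> (\<lambda>\<zeta>. (\<zeta> + z) / (\<zeta> - z)))"
    by (metis quad_diff quad_scale quad_Im_mat)
  also have "\<dots> = (LINT \<zeta>|quad_measure \<mu> v. (\<zeta> + z) / (\<zeta> - z))"
  proof (rule quad_matrix_measure_integral[OF nonneg_hermitian_measure_\<mu>])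
    show "(\<lambda>\<zeta>. (\<zeta> + z) / (\<zeta> - z)) \<in> borel_measurable circle_borel"
      using kernel_denominator(2)[OF _ z]
      by (intro borel_measurable_circle[OF refl] continuous_intros) auto
    show "norm ((\<zeta> + z) / (\<zeta> - z)) \<le> 2 / (1 - norm z)" if "\<zeta> \<in> sphere 0 1" for \<zeta>
      using kernel_denominator(3)[OF _ z] that by simp
  qed
  finally show ?thesis
    by (simp add: algebra_simps)
qed

text \<open>The radial limit of \<open>u - z\<close> times the quotient is known for every quadratic
  form; polarization transfers it to the entry, and its finiteness forces the factorization. Both
  the formula for the weights and the removability of the poles rest on this.\<close>

lemma quotient_decomposition:
  assumes u: "u \<in> circle_zeros Q"
  obtains g' d' where "det Q = [:- u, 1:] ^ order u (det Q) * d'"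
    "(P ** adjugate Q) $ i $ j = [:- u, 1:] ^ (order u (det Q) - 1) * g'"
    "poly d' u \<noteq> 0" "2 * u * \<mu> {u} $ i $ j = - poly g' u / poly d' u"
proof -
  define s where "s n = real n / real (Suc n)" for n
  have s: "0 \<le> s n" "s n < 1" for n
    by (auto simp: s_def)
  have s1: "s \<longlonglongrightarrow> 1"
    unfolding s_def by (rule LIMSEQ_n_over_Suc_n)
  define z where "z n = of_real (s n) * u" for n
  have u1: "norm u = 1" "poly (det Q) u = 0" "u \<in> sphere 0 1"
    using u by (auto simp: circle_zeros_iff)
  have nz: "norm (z n) < 1" for n
    using s[of n] u1 by (simp add: z_def norm_mult)
  then have zu: "z n \<noteq> u" for n
    using u1 by (metis less_irrefl)
  have lim: "z \<longlonglongrightarrow> u"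
    unfolding z_def using tendsto_mult_right[OF tendsto_of_real[OF s1], of u] by simp
  have uB: "{u} \<in> sets circle_borel"
    using u1 by (simp add: sets_circle_borel)
  have q: "(\<lambda>n. (u - z n) * quad v (mat_quotient P Q (z n))) \<longlonglongrightarrow> 2 * u * quad v (\<mu> {u})" for v
  proof -
    let ?c = "\<i> * of_real (Im (quad v (mat_quotient P Q 0)))"
    have "(\<lambda>n. (u - z n) * ?c + (u - z n) * (LINT \<zeta>|quad_measure \<mu> v. (\<zeta> + z n) / (\<zeta> - z n)))
        \<longlonglongrightarrow> (u - u) * ?c + 2 * u * measure (quad_measure \<mu> v) {u}"
      unfolding z_def
      by (intro tendsto_add tendsto_intros lim[unfolded z_def]
          herglotz_radial_limit[OF finite_quad_measure[OF nonneg_hermitian_measure_\<mu>]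
            sets_quad_measure u1(3) s s1])
    then show ?thesis
      unfolding quad_herglotz[OF nz] measure_quad_measure[OF nonneg_hermitian_measure_\<mu> uB]
      by (simp add: ring_distribs)
  qed
  have "(\<lambda>n. (u - z n) * mat_quotient P Q (z n) $ i $ j) \<longlonglongrightarrow> 2 * u * \<mu> {u} $ i $ j"
  proof -
    \<comment> \<open>Polarization with the scalar \<open>w\<close> moved into every form, so that
      each summand has the shape of the limit \<open>q\<close>.\<close>
    let ?e = "\<lambda>(w::complex) A. ((w * quad (axis i 1 + axis j 1) A) - \<i> * (w * quad (axis i 1 + axis j \<i>) A)
      - (1 - \<i>) * (w * quad (axis i 1) A + w * quad (axis j 1) A)) / 2"
    have e: "w * A $ i $ j = ?e w A" for w A
      by (subst polarization) (simp add: algebra_simps)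
    show ?thesis
      unfolding e by (intro tendsto_intros q) simp
  qed
  \<comment> \<open>Zeros of \<open>det Q\<close> may lie on the radius, where the polynomial
    quotient is not the value of \<open>mat_quotient\<close>; there are none close to
    \<open>u\<close>.\<close>
  moreover have "eventually (\<lambda>n. (u - z n) * mat_quotient P Q (z n) $ i $ j
      = (u - z n) * (poly ((P ** adjugate Q) $ i $ j) (z n) / poly (det Q) (z n))) sequentially"
  proof -
    have "filterlim z (at u) sequentially"
      using lim zu by (simp add: filterlim_at)
    from filterlim_iff[THEN iffD1, OF this, rule_format, OF eventually_poly_nonzero[OF det_Q]]
    show ?thesis
      by eventually_elim (simp add: mat_quotient_eq)
  qed
  ultimately have "(\<lambda>n. (u - z n) * (poly ((P ** adjugate Q) $ i $ j) (z n) / poly (det Q) (z n)))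
      \<longlonglongrightarrow> 2 * u * \<mu> {u} $ i $ j"
    by (rule Lim_transform_eventually)
  from simple_pole_decomposition[OF det_Q u1(2) lim zu this] that show ?thesis
    by blast
qed

text \<open>The derivatives at \<open>u\<close> are the factorial of \<open>m\<close> times
  \<open>poly d' u\<close> and the factorial of \<open>m - 1\<close> times \<open>poly g' u\<close>.
  The prefactor \<open>m\<close> cancels the factorials, leaving
  \<open>- poly g' u / (2 * u * poly d' u)\<close>, which is the point mass.\<close>

lemma residue_weight_eq:
  assumes u: "u \<in> circle_zeros Q"
  shows "(deriv ^^ order u (det Q)) (\<lambda>z. det (poly_mat Q z)) u \<noteq> 0"
    and "residue_weight P Q u = \<mu> {u}"
proof -
  let ?m = "order u (det Q)" and ?D = "\<lambda>z. det (poly_mat Q z)"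
  have u0: "u \<noteq> 0"
    using u by (auto simp: circle_zeros_iff)
  have D: "?D = poly (det Q)"
    by (simp add: fun_eq_iff poly_det)
  have deriv_D: "(deriv ^^ ?m) ?D u = fact ?m * poly d' u" if "det Q = [:- u, 1:] ^ ?m * d'" for d'
    unfolding D higher_deriv_poly using poly_higher_pderiv_power_mult[of ?m u d'] that by simp
  show ne: "(deriv ^^ ?m) ?D u \<noteq> 0"
    by (rule quotient_decomposition[OF u]) (simp add: deriv_D)
  have "residue_weight P Q u $ i $ j = \<mu> {u} $ i $ j" for i j
  proof (rule quotient_decomposition[OF u, of i j])
    fix g' d'
    assume *: "det Q = [:- u, 1:] ^ ?m * d'" "(P ** adjugate Q) $ i $ j = [:- u, 1:] ^ (?m - 1) * g'"
      "poly d' u \<noteq> 0" "2 * u * \<mu> {u} $ i $ j = - poly g' u / poly d' u"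
    have "(\<lambda>w. (poly_mat P w ** adjugate (poly_mat Q w)) $ i $ j) = poly ((P ** adjugate Q) $ i $ j)"
      by (simp add: fun_eq_iff poly_mat_mult_adjugate)
    then have "deriv_mat (?m - 1) (\<lambda>z. poly_mat P z ** adjugate (poly_mat Q z)) u $ i $ j
        = fact (?m - 1) * poly g' u"
      using poly_higher_pderiv_power_mult[of "?m - 1" u g'] *(2)
      by (simp add: deriv_mat_def higher_deriv_poly)
    then have "residue_weight P Q u $ i $ j
        = - of_nat ?m / (2 * u * (fact ?m * poly d' u)) * (fact (?m - 1) * poly g' u)"
      by (simp add: residue_weight_def Let_def map_matrix_def deriv_D[OF *(1)])
    also have "(fact ?m :: complex) = of_nat ?m * fact (?m - 1)"
      using order_pos[OF u] by (rule fact_reduce)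
    also have "- of_nat ?m / (2 * u * (of_nat ?m * fact (?m - 1) * poly d' u)) * (fact (?m - 1) * poly g' u)
        = (- poly g' u / poly d' u) / (2 * u)"
      using order_pos[OF u] u0 *(3) by (simp add: field_simps)
    also have "\<dots> = \<mu> {u} $ i $ j"
      unfolding *(4)[symmetric] using u0 by simp
    finally show ?thesis .
  qed
  then show "residue_weight P Q u = \<mu> {u}"
    by (simp add: vec_eq_iff)
qed

lemma nonneg_hermitian_residue_weight:
  assumes "u \<in> circle_zeros Q"
  shows "nonneg_hermitian (residue_weight P Q u)"
proof -
  have "{u} \<in> sets circle_borel"
    using assms by (simp add: sets_circle_borel circle_zeros_iff)
  then show ?thesis
    using nonneg_hermitian_measure_\<mu> by (simp add: residue_weight_eq[OF assms] nonneg_hermitian_measure_def)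
qed

lemma quad_residue_weight:
  assumes "u \<in> circle_zeros Q"
  shows "quad v (residue_weight P Q u) = of_real (measure (quad_measure \<mu> v) {u})"
  using assms measure_quad_measure[OF nonneg_hermitian_measure_\<mu>, of "{u}" v]
  by (simp add: residue_weight_eq sets_circle_borel circle_zeros_iff)

text \<open>Each summand of a quadratic form is a kernel with non-negative real part times a
  non-negative point mass.\<close>

lemma caratheodory_singular_part: "caratheodory (singular_part P Q)"
proof -
  have "(\<lambda>z. singular_part P Q z $ i $ j) holomorphic_on ball 0 1" for i j
    unfolding singular_part_entry
    by (intro holomorphic_intros) (auto simp: circle_zeros_iff)
  moreover have "0 \<le> Re (quad v (singular_part P Q z))" if "norm z < 1" for v z
  proof -
    have "Re ((u + z) / (u - z) * quad v (residue_weight P Q u))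
        = Re ((u + z) / (u - z)) * measure (quad_measure \<mu> v) {u}" if "u \<in> circle_zeros Q" for u
      unfolding quad_residue_weight[OF that] times_complex.sel by simp
    then have "Re (quad v (singular_part P Q z))
        = (\<Sum>u\<in>circle_zeros Q. Re ((u + z) / (u - z)) * measure (quad_measure \<mu> v) {u})"
      by (simp add: quad_singular_part)
    also have "\<dots> \<ge> 0"
      using Re_kernel_nonneg that by (intro sum_nonneg mult_nonneg_nonneg) (auto simp: circle_zeros_iff)
    finally show ?thesis .
  qed
  ultimately show ?thesis
    by (simp add: caratheodory_def holomorphic_mat_on_def nonneg_hermitian_Re_mat)
qed

section \<open>Removal of the poles on the circle\<close>

text \<open>Zeros of \<open>det Q\<close> inside the disc do no harm: there the quotient is
  holomorphic because it is a Caratheodory function.\<close>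

lemma difference_analytic:
  assumes "norm z < 1 \<or> poly (det Q) z \<noteq> 0"
  shows "(\<lambda>w. mat_quotient P Q w $ i $ j - singular_part P Q w $ i $ j) analytic_on {z}"
proof (intro analytic_on_diff)
  show "(\<lambda>w. mat_quotient P Q w $ i $ j) analytic_on {z}"
  proof (cases "poly (det Q) z = 0")
    case True
    then have "(\<lambda>w. mat_quotient P Q w $ i $ j) holomorphic_on ball 0 1" "z \<in> ball 0 1"
      using car assms by (auto simp: caratheodory_def holomorphic_mat_on_def)
    then show ?thesis
      by (auto simp: analytic_at intro!: exI[of _ "ball 0 1"])
  qed (rule mat_quotient_analytic)
  have "z \<noteq> u" if "u \<in> circle_zeros Q" for u
    using assms that by (auto simp: circle_zeros_iff)
  then show "(\<lambda>w. singular_part P Q w $ i $ j) analytic_on {z}"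
    unfolding singular_part_entry by (intro analytic_intros) auto
qed

lemma
  assumes "norm z < 1 \<or> poly (det Q) z \<noteq> 0"
  shows regular_part_analytic: "(\<lambda>w. regular_part P Q w $ i $ j) analytic_on {z}"
    and regular_part_eq: "regular_part P Q z = mat_quotient P Q z - singular_part P Q z"
  using remove_sings_analytic_on[OF difference_analytic[OF assms]]
    remove_sings_at_analytic[OF difference_analytic[OF assms]]
  by (simp_all add: regular_part_def remove_sings_mat_def vec_eq_iff)

text \<open>Near a point \<open>u\<close> of the zero set the difference has the form \<open>f z / (z - u) - h z\<close> with \<open>f\<close> and \<open>h\<close> analytic
  at \<open>u\<close>, and \<open>f u = 0\<close> by the choice of the weight.\<close>

lemma regular_part_analytic_circle_zero:
  assumes u: "u \<in> circle_zeros Q"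
  shows "(\<lambda>w. regular_part P Q w $ i $ j) analytic_on {u}"
proof (rule quotient_decomposition[OF u, of i j])
  let ?m = "order u (det Q)"
  fix g' d'
  assume *: "det Q = [:- u, 1:] ^ ?m * d'" "(P ** adjugate Q) $ i $ j = [:- u, 1:] ^ (?m - 1) * g'"
    "poly d' u \<noteq> 0" "2 * u * \<mu> {u} $ i $ j = - poly g' u / poly d' u"
  let ?W = "\<lambda>u. residue_weight P Q u $ i $ j"
  let ?H = "\<lambda>w. mat_quotient P Q w $ i $ j - singular_part P Q w $ i $ j"
  define f where "f z = poly g' z / poly d' z + (u + z) * ?W u" for z
  define h where "h z = (\<Sum>v\<in>circle_zeros Q - {u}. (v + z) / (v - z) * ?W v)" for z
  have f: "f analytic_on {u}" "f u = 0"
    using *(3,4) unfolding f_def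
    by (auto simp: residue_weight_eq[OF u] intro!: analytic_on_add analytic_on_divide poly_analytic analytic_intros)
  have h: "h analytic_on {u}"
    unfolding h_def by (intro analytic_intros) auto
  have ev: "eventually (\<lambda>z. poly (det Q) z \<noteq> 0 \<and> z \<noteq> u) (at u)"
    using eventually_poly_nonzero[OF det_Q, of u] by (simp add: eventually_conj_iff eventually_at_filter)
  have "eventually (\<lambda>z. f z / (z - u) - h z = ?H z) (at u)"
    using ev
  proof eventually_elim
    case (elim z)
    have "mat_quotient P Q z $ i $ j = poly ((P ** adjugate Q) $ i $ j) z / poly (det Q) z"
      using elim by (simp add: mat_quotient_eq)
    also have "poly (det Q) z = (z - u) ^ (?m - 1) * (z - u) * poly d' z"
      using order_pos[OF u] by (subst *(1)) (simp flip: power_Suc2)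
    also have "poly ((P ** adjugate Q) $ i $ j) z = (z - u) ^ (?m - 1) * poly g' z"
      by (subst *(2)) simp
    finally have q: "mat_quotient P Q z $ i $ j = poly g' z / poly d' z / (z - u)"
      using elim by simp
    have sp: "singular_part P Q z $ i $ j = (u + z) / (u - z) * ?W u + h z"
      unfolding singular_part_entry h_def by (rule sum.remove[OF finite_circle_zeros u])
    have flip: "(u + z) / (u - z) = - ((u + z) / (z - u))"
      by (metis minus_diff_eq minus_divide_right)
    show ?case
      unfolding q f_def sp flip add_divide_distrib[of "_ / _"] by simp
  qed
  moreover have "((\<lambda>z. f z / (z - u) - h z) \<longlongrightarrow> deriv f u - h u) (at u)"
    using analytic_at_imp_isCont[OF h]
    by (intro tendsto_diff analytic_at_tendsto_quotient f) (simp add: isCont_def)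
  ultimately have lim: "(?H \<longlongrightarrow> deriv f u - h u) (at u)"
    by (rule Lim_transform_eventually[rotated])
  \<comment> \<open>The finite limit makes the singularity removable only once it is known to be
    isolated, which holds because \<open>det Q\<close> has no other zero close to
    \<open>u\<close>.\<close>
  have "isolated_singularity_at ?H u"
  proof -
    obtain e where e: "e > 0" "\<And>z. z \<noteq> u \<Longrightarrow> dist z u < e \<Longrightarrow> poly (det Q) z \<noteq> 0"
      using ev unfolding eventually_at by blast
    have "?H analytic_on {z}" if "z \<in> ball u e - {u}" for z
      using that e(2)[of z] by (intro difference_analytic) (auto simp: dist_commute)
    then have "?H analytic_on ball u e - {u}"
      by (meson analytic_on_analytic_at)
    then show ?thesis
      using e(1) by (auto simp: isolated_singularity_at_def)
  qed
  from remove_sings_analytic_at[OF this lim] show ?thesis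
    by (simp add: regular_part_def remove_sings_mat_def)
qed

lemma regular_part_holomorphic:
  obtains r where "r > 1" "\<And>i j. (\<lambda>z. regular_part P Q z $ i $ j) holomorphic_on ball 0 r"
proof -
  define S where "S = {z. poly (det Q) z = 0 \<and> norm z > 1}"
  \<comment> \<open>The distance from 0 to the nearest zero of \<open>det Q\<close> beyond the
    circle. The 2 is an arbitrary number above 1 that keeps the minimum defined when there is no
    such zero.\<close>
  define r where "r = Min (insert 2 (norm ` S))"
  have S: "finite S"
    unfolding S_def by (rule finite_subset[OF _ poly_roots_finite[OF det_Q]]) auto
  show ?thesis
  proof (rule that)
    show "r > 1"
      unfolding r_def using S by (subst Min_gr_iff) (auto simp: S_def)
    fix i j
    have "(\<lambda>z. regular_part P Q z $ i $ j) analytic_on {z}" if "z \<in> ball 0 r" for z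
    proof (cases "z \<in> circle_zeros Q")
      case False
      have "z \<notin> S"
        using that S unfolding r_def by auto
      then show ?thesis
        using False by (intro regular_part_analytic) (auto simp: S_def circle_zeros_iff)
    qed (rule regular_part_analytic_circle_zero)
    then show "(\<lambda>z. regular_part P Q z $ i $ j) holomorphic_on ball 0 r"
      by (meson analytic_imp_holomorphic analytic_on_analytic_at)
  qed
qed

lemma rational_mat_regular_part: "rational_mat (regular_part P Q)"
proof -
  have "rational_fun (\<lambda>z. regular_part P Q z $ i $ j)" for i j
  proof (rule rational_fun_transform[OF _ det_Q])
    show "rational_fun (\<lambda>z. poly ((P ** adjugate Q) $ i $ j) z / poly (det Q) z
        + (\<Sum>u\<in>circle_zeros Q. - residue_weight P Q u $ i $ j * ((u + z) / (u - z))))"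
    proof (intro rational_fun_add rational_fun_sum rational_fun_cmult finite_circle_zeros)
      show "rational_fun (\<lambda>z. poly ((P ** adjugate Q) $ i $ j) z / poly (det Q) z)"
        using det_Q by (rule rational_funI) simp
      show "rational_fun (\<lambda>z. (u + z) / (u - z))" for u
        by (rule rational_funI[of "[:u, - 1:]" _ "[:u, 1:]"]) auto
    qed
    show "regular_part P Q z $ i $ j = poly ((P ** adjugate Q) $ i $ j) z / poly (det Q) z
        + (\<Sum>u\<in>circle_zeros Q. - residue_weight P Q u $ i $ j * ((u + z) / (u - z)))"
      if "poly (det Q) z \<noteq> 0" for z
      using that by (simp add: regular_part_eq mat_quotient_eq singular_part_entry sum_negf mult.commute)
  qed
  then show ?thesis
    by (simp add: rational_mat_def rational_fun_def)
qed

section \<open>The measure without its atoms at the zeros\<close>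

text \<open>A density keeps the space and the sets of \<open>circle_borel\<close>, so the results on
  finite measures on the circle apply directly.\<close>

definition diffuse :: "complex^'q \<Rightarrow> complex measure"
  where "diffuse v = density (quad_measure \<mu> v) (indicator (- circle_zeros Q))"

lemma sets_diffuse [simp, measurable_cong]: "sets (diffuse v) = sets circle_borel"
  and space_diffuse [simp]: "space (diffuse v) = sphere 0 1"
  by (simp_all add: diffuse_def)

lemma finite_measure_diffuse: "finite_measure (diffuse v)"
  unfolding diffuse_def
proof (rule finite_measure_density_indicator[OF finite_quad_measure[OF nonneg_hermitian_measure_\<mu>]])
  show "- circle_zeros Q \<inter> space (quad_measure \<mu> v) \<in> sets (quad_measure \<mu> v)"
    using finite_imp_closed[OF finite_circle_zeros] by (auto simp: sets_circle_borel)
qed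

text \<open>By the value of the weights, the atomic terms of the split Herglotz integral are exactly
  the form of \<open>singular_part\<close>. What remains is a Herglotz integral with an imaginary
  constant, as \<open>herglotz_density\<close> requires.\<close>

lemma quad_regular_part:
  assumes "norm z < 1"
  shows "quad v (regular_part P Q z) = \<i> * of_real (Im (quad v (mat_quotient P Q 0)))
    + (LINT \<zeta>|diffuse v. (\<zeta> + z) / (\<zeta> - z))"
proof -
  note fin = finite_quad_measure[OF nonneg_hermitian_measure_\<mu>, of v]
  have "quad v (singular_part P Q z)
      = (\<Sum>u\<in>circle_zeros Q. (u + z) / (u - z) * measure (quad_measure \<mu> v) {u})"
    by (simp add: quad_singular_part quad_residue_weight)
  then show ?thesis
    using assms quad_herglotz[OF assms, of v]
      integral_split_atoms[OF fin sets_quad_measure finite_circle_zeros circle_zeros_subset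
        integrable_kernel[OF fin sets_quad_measure assms]]
    by (simp add: regular_part_eq quad_diff diffuse_def)
qed

lemma Re_quad_regular_part:
  assumes "norm z < 1"
  shows "0 \<le> Re (quad v (regular_part P Q z))"
proof -
  have "Re (quad v (regular_part P Q z)) = (LINT \<zeta>|diffuse v. Re ((\<zeta> + z) / (\<zeta> - z)))"
    using integrable_kernel[OF finite_measure_diffuse[of v] sets_diffuse assms]
    by (simp add: quad_regular_part[OF assms] del: complex_Re_numeral)
  also have "\<dots> \<ge> 0"
    by (intro integral_nonneg_AE AE_I2 Re_kernel_nonneg assms) simp
  finally show ?thesis .
qed

lemma caratheodory_regular_part: "caratheodory (regular_part P Q)"
proof -
  obtain r where r: "r > 1" "\<And>i j. (\<lambda>z. regular_part P Q z $ i $ j) holomorphic_on ball 0 r"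
    using regular_part_holomorphic by blast
  have "(\<lambda>z. regular_part P Q z $ i $ j) holomorphic_on ball 0 1" for i j
    by (rule holomorphic_on_subset[OF r(2)]) (use r(1) in auto)
  then show ?thesis
    using Re_quad_regular_part
    by (simp add: caratheodory_def holomorphic_mat_on_def nonneg_hermitian_Re_mat)
qed

text \<open>Quadratic forms determine a matrix. For fixed \<open>v\<close> the integral term is the
  mass of \<open>diffuse v\<close> by \<open>herglotz_density\<close>, and the sum consists of the
  atoms that \<open>diffuse v\<close> omits.\<close>

lemma herglotz_measure_eq:
  assumes B: "B \<in> sets circle_borel"
  shows "\<mu> B = (1 / (2*pi)) *\<^sub>R (LINT \<zeta>:B|arc_length. Re_mat (regular_part P Q \<zeta>)) +
    (\<Sum>u\<in>circle_zeros Q. indicator B u *\<^sub>R residue_weight P Q u)"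
proof (rule quad_eqI)
  fix v
  obtain r where r: "r > 1" "\<And>i j. (\<lambda>z. regular_part P Q z $ i $ j) holomorphic_on ball 0 r"
    using regular_part_holomorphic by blast
  have sub: "sphere 0 1 \<subseteq> ball (0::complex) r"
    using r(1) by auto
  have cont: "continuous_on (sphere 0 1) (\<lambda>z. regular_part P Q z $ i $ j)" for i j
    by (rule continuous_on_subset[OF holomorphic_on_imp_continuous_on[OF r(2)] sub])
  \<comment> \<open>The entry formula yields continuity on the circle and hence integrability of the
    matrix function, which is what allows \<open>quad v\<close> to pass under its integral.\<close>
  have "Re_mat A = (\<chi> i j. (A $ i $ j + cnj (A $ j $ i)) / 2)" for A :: "complex^'q^'q"
    by (simp add: Re_mat_def conj_transpose_def map_matrix_def vec_eq_iff)
  then have "continuous_on (sphere 0 1) (\<lambda>\<zeta>. Re_mat (regular_part P Q \<zeta>))"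
    by (simp only:) (intro continuous_on_vec_lambda continuous_on_divide continuous_on_add
        continuous_on_cnj continuous_on_const cont, simp)
  then have int: "integrable arc_length (\<lambda>\<zeta>. Re_mat (regular_part P Q \<zeta>))"
    by (rule integrable_circle[OF finite_measure_arc_length sets_arc_length])
  have hol: "(\<lambda>z. quad v (regular_part P Q z)) holomorphic_on ball 0 r"
    unfolding quad_altdef by (intro holomorphic_intros r)
  have "quad v (LINT \<zeta>:B|arc_length. Re_mat (regular_part P Q \<zeta>))
      = (LINT \<zeta>:B|arc_length. quad v (Re_mat (regular_part P Q \<zeta>)))"
    unfolding set_lebesgue_integral_def
    using integral_bounded_linear[OF bounded_linear_quad integrable_mult_indicator[OF _ int], of B v] B
    by (simp add: quad_scaleR)
  also have "\<dots> = of_real (LINT \<zeta>:B|arc_length. Re (quad v (regular_part P Q \<zeta>)))"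
    unfolding set_lebesgue_integral_def quad_Re_mat
    by (simp add: scaleR_conv_of_real flip: integral_of_real of_real_mult)
  finally have "quad v ((1 / (2*pi)) *\<^sub>R (LINT \<zeta>:B|arc_length. Re_mat (regular_part P Q \<zeta>)))
      = of_real ((LINT \<zeta>:B|arc_length. Re (quad v (regular_part P Q \<zeta>))) / (2 * pi))"
    by (simp only: quad_scaleR) (simp add: scaleR_conv_of_real)
  also have "(LINT \<zeta>:B|arc_length. Re (quad v (regular_part P Q \<zeta>))) / (2 * pi) = measure (diffuse v) B"
    by (rule herglotz_density[OF finite_measure_diffuse sets_diffuse quad_regular_part hol r(1)
          Re_quad_regular_part B, symmetric])
  finally have ac: "quad v ((1 / (2*pi)) *\<^sub>R (LINT \<zeta>:B|arc_length. Re_mat (regular_part P Q \<zeta>)))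
      = of_real (measure (diffuse v) B)" .
  have "quad v (\<mu> B) = of_real (measure (quad_measure \<mu> v) B)"
    by (rule measure_quad_measure[OF nonneg_hermitian_measure_\<mu> B, symmetric])
  also have "\<dots> = of_real (measure (diffuse v) B)
      + (\<Sum>u\<in>circle_zeros Q. of_real (indicator B u * measure (quad_measure \<mu> v) {u}))"
    unfolding diffuse_def
    using measure_split_atoms[OF finite_quad_measure[OF nonneg_hermitian_measure_\<mu>] sets_quad_measure
        finite_circle_zeros circle_zeros_subset B] by simp
  finally show "quad v (\<mu> B) = quad v ((1 / (2*pi)) *\<^sub>R (LINT \<zeta>:B|arc_length. Re_mat (regular_part P Q \<zeta>)) +
      (\<Sum>u\<in>circle_zeros Q. indicator B u *\<^sub>R residue_weight P Q u))"
    unfolding quad_add quad_sum ac unfolding quad_scaleR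
    by (simp add: quad_residue_weight scaleR_conv_of_real)
qed

end

theorem theorem2p14:
  fixes P Q :: "complex poly^'q^'q" and \<mu> :: "complex set \<Rightarrow> complex^'q^'q"
  assumes "det Q \<noteq> 0"
    and "caratheodory (mat_quotient P Q)"
    and "riesz_herglotz_measure (mat_quotient P Q) \<mu>"
  shows "finite (circle_zeros Q) \<and> circle_zeros Q \<subseteq> sphere 0 1 \<and>
    (\<forall>u\<in>circle_zeros Q.
      0 < order u (det Q) \<and>
      (deriv ^^ order u (det Q)) (\<lambda>z. det (poly_mat Q z)) u \<noteq> 0 \<and>
      nonneg_hermitian (residue_weight P Q u) \<and>
      residue_weight P Q u = \<mu> {u}) \<and>
    (rational_mat (regular_part P Q) \<and>
      (\<exists>r>1. holomorphic_mat_on (regular_part P Q) (ball 0 r)) \<and>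
      caratheodory (regular_part P Q) \<and>
      caratheodory (singular_part P Q)) \<and>
    (\<forall>B\<in>sets circle_borel.
      \<mu> B = (1 / (2*pi)) *\<^sub>R (LINT \<zeta>:B|arc_length. Re_mat (regular_part P Q \<zeta>)) +
        (\<Sum>u\<in>circle_zeros Q. indicator B u *\<^sub>R residue_weight P Q u))"
proof (intro conjI ballI)
  show "\<exists>r>1. holomorphic_mat_on (regular_part P Q) (ball 0 r)"
    using regular_part_holomorphic[OF assms] unfolding holomorphic_mat_on_def by metis
  show "nonneg_hermitian (residue_weight P Q u)" if "u \<in> circle_zeros Q" for u
    by (rule nonneg_hermitian_residue_weight[OF assms that])
qed (use assms in \<open>simp_all add: finite_circle_zeros circle_zeros_subset order_pos residue_weight_eq
    rational_mat_regular_part caratheodory_regular_part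
    caratheodory_singular_part herglotz_measure_eq\<close>)

end
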